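(* Let $T,N\in\mathcal{B}^{0,1}(V_n)$ be such that $T$ and $N$ commute ($TN=NT$), let $\varepsilon>0$, and suppose $\sigma_S(N)\subset B_\varepsilon(0)$. Then for any $s\in\rho_S(T)$ with $\operatorname{dist}(s,\sigma_S(T))>\varepsilon$ the identities $$S_L^{-1}(s,T+N)=\sum_{m=0}^\infty N^m\,S_L^{-(m+1)}(s,T)\qquad\text{and}\qquad S_R^{-1}(s,T+N)=\sum_{m=0}^\infty S_R^{-(m+1)}(s,T)\,N^m$$ hold true. Moreover, these series converge uniformly (in $s$, in operator norm) on any set $C\subset\mathbb{R}^{n+1}$ with $\operatorname{dist}(C,\sigma_S(T))>\varepsilon$.
   Context: Setting: $n\ge 1$; $\mathbb{R}_n$ is the real Clifford algebra with generators $e_1,\dots,e_n$, $e_ie_j+e_je_i=-2\delta_{ij}$, and basis $e_A$, $A\subset\{1,\dots,n\}$. A point of $\mathbb{R}^{n+1}$ is identified with the paravector $s=s_0+\sum_{j=1}^n s_je_j\in\mathbb{R}_n$; $\overline{s}=s_0-\sum_j s_je_j$, $|s|$ is the Euclidean norm, $B_r(0)$ is the open Euclidean ball of radius $r$ about $0$ in $\mathbb{R}^{n+1}$, $\operatorname{dist}(s,A)=\inf_{x\in A}|s-x|$ and $\operatorname{dist}(C,A)=\inf_{s\in C}\operatorname{dist}(s,A)$. $V$ is a real Banach space, $V_n=V\otimes\mathbb{R}_n$ with elements $v=\sum_A v_Ae_A$ and $\|v\|^2=\sum_A\|v_A\|^2$; it is a two-sided $\mathbb{R}_n$-module. For bounded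 linear $T_A:V\to V$, the operator $\sum_A T_Ae_A$ acts by $v\mapsto\sum_{A,B}T_A(v_B)e_Ae_B$; a scalar $a\in\mathbb{R}_n$ is regarded as the operator $v\mapsto av$, so $aT$ and $Ta$ are compositions. $\mathcal{B}^{0,1}(V_n)$ is the set of operators $T=T_0+\sum_{j=1}^n e_jT_j$ with $T_0,\dots,T_n$ bounded linear operators on $V$ (not assumed to commute with each other). $\mathcal{I}$ is the identity; invertible means invertible as a bounded operator on $V_n$. $\sigma_S(T)=\{s\in\mathbb{R}^{n+1}: T^2-2s_0T+|s|^2\mathcal{I}\text{ is not invertible}\}$ is the $S$-spectrum, $\rho_S(T)=\mathbb{R}^{n+1}\setminus\sigma_S(T)$. For $s\in\rho_S(T)$ and integers $m\ge0$, $$S_L^{-m}(s,T):=(T^2-2s_0T+|s|^2\mathcal{I})^{-m}(\overline{s}\,\mathcal{I}-T)^{\star_\ell m},\qquad S_R^{-m}(s,T):=(\overline{s}\,\mathcal{I}-T)^{\star_r m}(T^2-2s_0T+|s|^2\mathcal{I})^{-m},$$ where $(\overline{s}\,\mathcal{I}-T)^{\star_\ell m}=\sum_{k=0}^m\binom{m}{k}(-T)^k\,\overline{s}^{\,m-k}$ and $(\overline{s}\,\mathcal{I}-T)^{\star_r m}=\sum_{k=0}^m\binom{m}{k}\overline{s}^{\,m-k}(-T)^k$. In particular $S_L^{-1}(s,T)=(T^2-2s_0T+|s|^2\mathcal{I})^{-1}(\overline{s}\,\mathcal{I}-T)$ and $S_R^{-1}(s,T)=(\overline{s}\,\mathcal{I}-T)(T^2-2s_0T+|s|^2\mathcal{I})^{-1}$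 are the left and right $S$-resolvent operators. (Under the hypotheses of the claim, $s\in\rho_S(T+N)$; this is part of what makes the left-hand sides meaningful.) *)

theory Defs
  imports "HOL-Analysis.Analysis"
begin

section \<open>The real Clifford algebra\<close>

text \<open>
  The generators \<open>e_j\<close> are indexed by a finite linearly ordered type \<open>'n\<close>, so that the
  algebra \<open>\<real>_n\<close> has \<open>n = CARD('n) \<ge> 1\<close>.  An element is given by its
  coefficients with respect to the basis \<open>e_A = e_{i_1} \<dots> e_{i_k}\<close>, where
  \<open>A = {i_1 < \<dots> < i_k}\<close>.
\<close>

typedef 'n clifford = "UNIV :: ('n set \<Rightarrow> real) set"
  morphisms clifford_coeff Clifford
  by simp

setup_lifting type_definition_clifford

text \<open>
  \<open>e_A * e_B = clifford_sign A B * e_{A \<triangle> B}\<close>: to sort the product, every pair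
  \<open>i \<in> A\<close>, \<open>j \<in> B\<close> with \<open>j < i\<close> costs a transposition, and every \<open>i \<in> A \<inter> B\<close> a
  factor \<open>e_i * e_i = -1\<close>.
\<close>

definition clifford_sign :: "'n::linorder set \<Rightarrow> 'n set \<Rightarrow> real" where
  "clifford_sign A B = (-1) ^ card {(i, j) \<in> A \<times> B. j \<le> i}"

instantiation clifford :: ("{finite,linorder}") "{times,one,plus,minus,uminus,zero,scaleR}"
begin

lift_definition zero_clifford :: "'a clifford" is "\<lambda>A. 0" .
lift_definition one_clifford :: "'a clifford" is "\<lambda>A. if A = {} then 1 else 0" .
lift_definition plus_clifford :: "'a clifford \<Rightarrow> 'a clifford \<Rightarrow> 'a clifford" is
  "\<lambda>x y A. x A + y A" .
lift_definition minus_clifford :: "'a clifford \<Rightarrow> 'a clifford \<Rightarrow> 'a clifford" is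
  "\<lambda>x y A. x A - y A" .
lift_definition uminus_clifford :: "'a clifford \<Rightarrow> 'a clifford" is "\<lambda>x A. - x A" .
lift_definition scaleR_clifford :: "real \<Rightarrow> 'a clifford \<Rightarrow> 'a clifford" is
  "\<lambda>r x A. r * x A" .
lift_definition times_clifford :: "'a clifford \<Rightarrow> 'a clifford \<Rightarrow> 'a clifford" is
  "\<lambda>x y C. \<Sum>A\<in>UNIV. \<Sum>B\<in>UNIV. if sym_diff A B = C then x A * y B * clifford_sign A B else 0" .

instance ..

end

lemma clifford_eqI: "(\<And>A. clifford_coeff x A = clifford_coeff y A) \<Longrightarrow> x = y"
  by transfer auto

lemma clifford_sign_prod:
  fixes A B :: "'n::{finite,linorder} set"
  shows "clifford_sign A B = (\<Prod>i\<in>UNIV. \<Prod>j\<in>UNIV. if i \<in> A \<and> j \<in> B \<and> j \<le> i then -1 else 1)"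
proof -
  have "clifford_sign A B = (\<Prod>p\<in>{(i, j) \<in> A \<times> B. j \<le> i}. -1)"
    by (simp add: clifford_sign_def)
  also have "\<dots> = (\<Prod>(i,j)\<in>UNIV \<times> UNIV. if i \<in> A \<and> j \<in> B \<and> j \<le> i then -1 else 1)"
    by (intro prod.mono_neutral_cong_left) (auto split: if_splits)
  also have "\<dots> = (\<Prod>i\<in>UNIV. \<Prod>j\<in>UNIV. if i \<in> A \<and> j \<in> B \<and> j \<le> i then -1 else 1)"
    by (rule prod.cartesian_product[symmetric])
  finally show ?thesis .
qed

lemma clifford_sign_sym_diff_left:
  fixes A B C :: "'n::{finite,linorder} set"
  shows "clifford_sign (sym_diff A B) C = clifford_sign A C * clifford_sign B C"
  unfolding clifford_sign_prod prod.distrib[symmetric]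
  by (intro prod.cong refl) auto

lemma clifford_sign_sym_diff_right:
  fixes A B C :: "'n::{finite,linorder} set"
  shows "clifford_sign A (sym_diff B C) = clifford_sign A B * clifford_sign A C"
  unfolding clifford_sign_prod prod.distrib[symmetric]
  by (intro prod.cong refl) auto

lemma clifford_sign_empty [simp]: "clifford_sign {} B = 1" "clifford_sign A {} = 1"
  by (simp_all add: clifford_sign_def)

lemma sym_diff_eq_iff: "sym_diff A B = C \<longleftrightarrow> B = sym_diff A C"
  by blast

lemma coeff_times:
  fixes x y :: "'n::{finite,linorder} clifford"
  shows "clifford_coeff (x * y) C =
    (\<Sum>A\<in>UNIV. clifford_coeff x A * clifford_coeff y (sym_diff A C) * clifford_sign A (sym_diff A C))"
  by (simp add: times_clifford.rep_eq sym_diff_eq_iff sum.delta)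

instance clifford :: ("{finite,linorder}") real_algebra_1
proof
  fix x y z :: "'a clifford" and r s :: real
  show "x + y + z = x + (y + z)" "x + y = y + x" "0 + x = x" "- x + x = 0" "x - y = x + - y"
    "r *\<^sub>R (x + y) = r *\<^sub>R x + r *\<^sub>R y" "(r + s) *\<^sub>R x = r *\<^sub>R x + s *\<^sub>R x"
    "r *\<^sub>R s *\<^sub>R x = (r * s) *\<^sub>R x" "1 *\<^sub>R x = x"
    by (transfer; simp add: algebra_simps fun_eq_iff)+
  show "(0::'a clifford) \<noteq> 1" by transfer (auto simp: fun_eq_iff)
  show "(x + y) * z = x * z + y * z" "x * (y + z) = x * y + x * z"
    by (rule clifford_eqI; simp add: coeff_times plus_clifford.rep_eq algebra_simps sum.distrib)+
  show "r *\<^sub>R x * y = r *\<^sub>R (x * y)" "x * r *\<^sub>R y = r *\<^sub>R (x * y)"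
    by (rule clifford_eqI; simp add: coeff_times scaleR_clifford.rep_eq algebra_simps sum_distrib_left)+
  show "1 * x = x"
    by (rule clifford_eqI) (simp add: coeff_times one_clifford.rep_eq if_distrib if_distribR cong: if_cong)
  show "x * 1 = x"
  proof (rule clifford_eqI)
    fix C
    have "clifford_coeff (x * 1) C =
        (\<Sum>A\<in>UNIV. if A = C then clifford_coeff x A else 0)"
      unfolding coeff_times one_clifford.rep_eq by (intro sum.cong refl) auto
    then show "clifford_coeff (x * 1) C = clifford_coeff x C" by simp
  qed
  show "x * y * z = x * (y * z)"
  proof (rule clifford_eqI)
    fix D
    let ?x = "clifford_coeff x" and ?y = "clifford_coeff y" and ?z = "clifford_coeff z"
    let ?g = "clifford_sign :: 'a set \<Rightarrow> 'a set \<Rightarrow> real"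
    have "clifford_coeff (x * y * z) D =
      (\<Sum>E\<in>UNIV. \<Sum>A\<in>UNIV. ?x A * ?y (sym_diff A E) * ?z (sym_diff E D) *
         (?g A (sym_diff A E) * ?g E (sym_diff E D)))"
      by (simp add: coeff_times sum_distrib_right sum_distrib_left mult_ac)
    also have "\<dots> = (\<Sum>A\<in>UNIV. \<Sum>E\<in>UNIV. ?x A * ?y (sym_diff A E) * ?z (sym_diff E D) *
         (?g A (sym_diff A E) * ?g E (sym_diff E D)))"
      by (rule sum.swap)
    also have "\<dots> = (\<Sum>A\<in>UNIV. \<Sum>B\<in>UNIV. ?x A * ?y B * ?z (sym_diff B (sym_diff A D)) *
         (?g A (sym_diff A D) * ?g B (sym_diff B (sym_diff A D))))"
    proof (rule sum.cong[OF refl])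
      fix A :: "'a set"
      show "(\<Sum>E\<in>UNIV. ?x A * ?y (sym_diff A E) * ?z (sym_diff E D) *
           (?g A (sym_diff A E) * ?g E (sym_diff E D)))
        = (\<Sum>B\<in>UNIV. ?x A * ?y B * ?z (sym_diff B (sym_diff A D)) *
           (?g A (sym_diff A D) * ?g B (sym_diff B (sym_diff A D))))"
      proof (rule sum.reindex_bij_witness[of _ "\<lambda>B. sym_diff A B" "\<lambda>E. sym_diff A E"])
        fix E :: "'a set"
        let ?B = "sym_diff A E" and ?C = "sym_diff E D"
        have C: "sym_diff ?B (sym_diff A D) = ?C" by blast
        have E: "E = sym_diff A ?B" by blast
        have D: "sym_diff A D = sym_diff ?B ?C" by blast
        have "?g E ?C = ?g A ?C * ?g ?B ?C"
          by (subst E) (rule clifford_sign_sym_diff_left)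
        moreover have "?g A (sym_diff A D) = ?g A ?B * ?g A ?C"
          by (subst D) (rule clifford_sign_sym_diff_right)
        ultimately have "?g A (sym_diff A D) * ?g ?B ?C = ?g A ?B * ?g E ?C" by simp
        then show "?x A * ?y ?B * ?z (sym_diff ?B (sym_diff A D)) *
            (?g A (sym_diff A D) * ?g ?B (sym_diff ?B (sym_diff A D)))
          = ?x A * ?y ?B * ?z ?C * (?g A ?B * ?g E ?C)"
          unfolding C by simp
      qed auto
    qed
    also have "\<dots> = clifford_coeff (x * (y * z)) D"
      by (simp add: coeff_times sum_distrib_right sum_distrib_left mult_ac)
    finally show "clifford_coeff (x * y * z) D = clifford_coeff (x * (y * z)) D" .
  qed
qed

lift_definition e_basis :: "'n set \<Rightarrow> 'n clifford" is "\<lambda>A B. if B = A then 1 else 0" .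

abbreviation e_gen :: "'n \<Rightarrow> 'n clifford" where
  "e_gen j \<equiv> e_basis {j}"

lemma e_basis_times:
  fixes A B :: "'n::{finite,linorder} set"
  shows "e_basis A * e_basis B = clifford_sign A B *\<^sub>R e_basis (sym_diff A B)"
proof (rule clifford_eqI)
  fix C
  have "clifford_coeff (e_basis A * e_basis B) C =
     (\<Sum>A'\<in>UNIV. if A' = A then (if sym_diff A B = C then clifford_sign A B else 0) else 0)"
    unfolding coeff_times e_basis.rep_eq
    by (intro sum.cong refl) auto
  then show "clifford_coeff (e_basis A * e_basis B) C =
      clifford_coeff (clifford_sign A B *\<^sub>R e_basis (sym_diff A B)) C"
    by (auto simp: e_basis.rep_eq scaleR_clifford.rep_eq)
qed

lemma e_basis_empty: "(e_basis {} :: 'n::{finite,linorder} clifford) = 1"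
  by transfer auto

lemma e_gen_anticommute:
  fixes i j :: "'n::{finite,linorder}"
  shows "e_gen i * e_gen j + e_gen j * e_gen i = (if i = j then -2 else 0)"
proof (cases "i = j")
  case True
  have "{(a, b). a = j \<and> b = j \<and> b \<le> a} = {(j, j)}" by auto
  then have "e_gen j * e_gen j = - 1"
    by (simp add: e_basis_times e_basis_empty clifford_sign_def)
  with True show ?thesis by simp
next
  case False
  have "clifford_sign {i} {j} = - clifford_sign {j} {i}"
  proof -
    have *: "{(a, b). a = k \<and> b = l \<and> b \<le> a} = (if l \<le> k then {(k, l)} else {})" for k l :: 'n
      by auto
    show ?thesis using False by (auto simp: clifford_sign_def *)
  qed
  moreover have "sym_diff {i} {j} = sym_diff {j} {i}" by blast
  ultimately show ?thesis using False by (simp add: e_basis_times)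
qed

lemma e_basis_insert:
  fixes A :: "'n::{finite,linorder} set"
  assumes "\<And>j. j \<in> A \<Longrightarrow> i < j"
  shows "e_basis (insert i A) = e_gen i * e_basis A"
proof -
  have "i \<notin> A" using assms by blast
  then have "sym_diff {i} A = insert i A" by auto
  moreover have "{(a, b) \<in> {i} \<times> A. b \<le> a} = {}" using assms by fastforce
  ultimately show ?thesis by (simp only: e_basis_times clifford_sign_def card.empty) simp
qed


section \<open>Paravectors\<close>

text \<open>A point \<open>s\<close> of \<open>\<real>^{n+1}\<close> is the pair of \<open>s_0\<close> and \<open>(s_j)_j\<close>; the norm of this product
  type is the Euclidean one.\<close>

type_synonym 'n paravector = "real \<times> (real, 'n) vec"

definition paravector :: "'n::{finite,linorder} paravector \<Rightarrow> 'n clifford" where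
  "paravector s = of_real (fst s) + (\<Sum>j\<in>UNIV. (snd s $ j) *\<^sub>R e_gen j)"

definition cnj_paravector :: "'n::finite paravector \<Rightarrow> 'n paravector" where
  "cnj_paravector s = (fst s, - snd s)"

text \<open>Distances are taken in the extended reals, so that the infimum over the empty set is
  \<open>\<infinity>\<close> (unlike in \<open>infdist\<close> and \<open>setdist\<close>).\<close>

definition dist_point_set :: "'a::metric_space \<Rightarrow> 'a set \<Rightarrow> ereal" where
  "dist_point_set s A = (INF x\<in>A. ereal (dist s x))"

definition dist_set_set :: "'a::metric_space set \<Rightarrow> 'a set \<Rightarrow> ereal" where
  "dist_set_set C A = (INF s\<in>C. dist_point_set s A)"


section \<open>Operators on the Clifford module\<close>

text \<open>\<open>V_n = V \<otimes> \<real>_n\<close>: the component of \<open>v\<close> at \<open>A\<close> is \<open>v_A\<close>, and the norm of this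
  type is \<open>\<parallel>v\<parallel>\<^sup>2 = \<Sum>_A \<parallel>v_A\<parallel>\<^sup>2\<close>.\<close>

type_synonym ('v, 'n) cmodule = "('v, 'n set) vec"

type_synonym ('v, 'n) cop = "('v, 'n) cmodule \<Rightarrow>\<^sub>L ('v, 'n) cmodule"

definition ctensor :: "'v::real_normed_vector \<Rightarrow> 'n::finite clifford \<Rightarrow> ('v, 'n) cmodule" where
  "ctensor w a = (\<chi> A. clifford_coeff a A *\<^sub>R w)"

lemma bounded_linear_ctensor:
  fixes a :: "'n::finite clifford"
  shows "bounded_linear (\<lambda>w :: 'v::real_normed_vector. ctensor w a)"
proof (rule bounded_linear_intro)
  fix w v :: 'v and r
  show "ctensor (w + v) a = ctensor w a + ctensor v a" "ctensor (r *\<^sub>R w) a = r *\<^sub>R ctensor w a"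
    by (simp_all add: ctensor_def vec_eq_iff algebra_simps)
  have "norm (ctensor w a) \<le> (\<Sum>A\<in>UNIV. norm (ctensor w a $ A))"
    unfolding norm_vec_def by (rule L2_set_le_sum) simp
  also have "\<dots> = norm w * (\<Sum>A\<in>UNIV. \<bar>clifford_coeff a A\<bar>)"
    by (simp add: ctensor_def sum_distrib_left mult.commute)
  finally show "norm (ctensor w a) \<le> norm w * (\<Sum>A\<in>UNIV. \<bar>clifford_coeff a A\<bar>)" .
qed

text \<open>The operator \<open>\<Sum>_A T_A e_A\<close>.\<close>

lift_definition clifford_op ::
  "('n::{finite,linorder} set \<Rightarrow> 'v::real_normed_vector \<Rightarrow>\<^sub>L 'v) \<Rightarrow> ('v, 'n) cop" is
  "\<lambda>T v. \<Sum>A\<in>UNIV. \<Sum>B\<in>UNIV. ctensor (T A (v $ B)) (e_basis A * e_basis B)"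
  by (intro bounded_linear_sum bounded_linear_compose[OF bounded_linear_ctensor]
      bounded_linear_compose[OF _ bounded_linear_vec_nth])

definition base_op :: "('v::real_normed_vector \<Rightarrow>\<^sub>L 'v) \<Rightarrow> ('v, 'n::{finite,linorder}) cop" where
  "base_op T = clifford_op (\<lambda>A. if A = {} then T else 0)"

definition scalar_op :: "'n clifford \<Rightarrow> ('v::real_normed_vector, 'n::{finite,linorder}) cop" where
  "scalar_op a = clifford_op (\<lambda>A. clifford_coeff a A *\<^sub>R id_blinfun)"

definition B01 :: "('v::real_normed_vector, 'n::{finite,linorder}) cop set" where
  "B01 = {base_op T0 + (\<Sum>j\<in>UNIV. scalar_op (e_gen j) o\<^sub>L base_op (T j)) | T0 T. True}"

lemma coeff_sum: "clifford_coeff (\<Sum>i\<in>I. f i) A = (\<Sum>i\<in>I. clifford_coeff (f i) A)"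
  for f :: "'i \<Rightarrow> 'n::{finite,linorder} clifford"
  by (induction I rule: infinite_finite_induct) (simp_all add: zero_clifford.rep_eq plus_clifford.rep_eq)

lemma clifford_expansion: "(\<Sum>A\<in>UNIV. clifford_coeff a A *\<^sub>R e_basis A) = a"
  for a :: "'n::{finite,linorder} clifford"
  by (rule clifford_eqI)
    (simp add: coeff_sum scaleR_clifford.rep_eq e_basis.rep_eq if_distrib cong: if_cong)

lemma ctensor_sum_right: "ctensor w (\<Sum>i\<in>I. f i) = (\<Sum>i\<in>I. ctensor w (f i))"
  for f :: "'i \<Rightarrow> 'n::{finite,linorder} clifford"
  by (simp add: ctensor_def vec_eq_iff coeff_sum scaleR_sum_left)

lemma ctensor_scaleR: "ctensor (r *\<^sub>R w) a = ctensor w (r *\<^sub>R a)"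
  for a :: "'n::{finite,linorder} clifford"
  by (simp add: ctensor_def vec_eq_iff scaleR_clifford.rep_eq mult.commute)

lemma ctensor_expansion: "(\<Sum>B\<in>UNIV. ctensor (v $ B) (e_basis B)) = v"
  for v :: "('v::real_normed_vector, 'n::{finite,linorder}) cmodule"
  by (simp add: ctensor_def vec_eq_iff e_basis.rep_eq if_distrib if_distribR cong: if_cong)

lemma base_op_apply:
  fixes v :: "('v::real_normed_vector, 'n::{finite,linorder}) cmodule"
  shows "base_op T v $ B = T (v $ B)"
proof -
  have "base_op T v = (\<Sum>A::'n set\<in>UNIV. if A = {} then \<Sum>B\<in>UNIV. ctensor (T (v $ B)) (e_basis B) else 0)"
    unfolding base_op_def clifford_op.rep_eq
  proof (rule sum.cong[OF refl])
    fix A :: "'n set"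
    show "(\<Sum>B\<in>UNIV. ctensor (blinfun_apply (if A = {} then T else 0) (v $ B)) (e_basis A * e_basis B))
        = (if A = {} then \<Sum>B\<in>UNIV. ctensor (T (v $ B)) (e_basis B) else 0)"
      by (simp add: e_basis_empty ctensor_def vec_eq_iff)
  qed
  also have "\<dots> = (\<Sum>B\<in>UNIV. ctensor (T (v $ B)) (e_basis B))"
    by simp
  also have "\<dots> = (\<chi> B. T (v $ B))"
    using ctensor_expansion[of "\<chi> B. T (v $ B)"] by simp
  finally show ?thesis by simp
qed

lemma scalar_op_apply: "scalar_op a v = (\<Sum>B\<in>UNIV. ctensor (v $ B) (a * e_basis B))"
proof -
  have "scalar_op a v = (\<Sum>B\<in>UNIV. \<Sum>A\<in>UNIV. ctensor (v $ B) (clifford_coeff a A *\<^sub>R e_basis A * e_basis B))"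
    unfolding scalar_op_def clifford_op.rep_eq
    by (subst sum.swap) (simp add: scaleR_blinfun.rep_eq ctensor_scaleR)
  then show ?thesis
    by (simp only: ctensor_sum_right[symmetric] sum_distrib_right[symmetric] clifford_expansion)
qed

lemma scalar_op_ctensor: "scalar_op a (ctensor w b) = ctensor w (a * b)"
proof -
  have "scalar_op a (ctensor w b) = ctensor w (a * (\<Sum>B\<in>UNIV. clifford_coeff b B *\<^sub>R e_basis B))"
    unfolding scalar_op_apply sum_distrib_left ctensor_sum_right
    by (simp add: ctensor_def ctensor_scaleR[unfolded ctensor_def] scaleR_clifford.rep_eq mult.commute)
  then show ?thesis by (simp only: clifford_expansion)
qed

lemma scalar_op_mult: "scalar_op (a * b) = scalar_op a o\<^sub>L scalar_op b"
  by (rule blinfun_eqI)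
    (simp add: scalar_op_apply[of "a * b"] scalar_op_apply[of b] blinfun.sum_right
      scalar_op_ctensor mult.assoc)

lemma scalar_op_one: "scalar_op 1 = id_blinfun"
  by (rule blinfun_eqI) (simp add: scalar_op_apply ctensor_expansion)

definition op_invertible :: "('a::real_normed_vector \<Rightarrow>\<^sub>L 'a) \<Rightarrow> bool" where
  "op_invertible T \<longleftrightarrow> (\<exists>S. S o\<^sub>L T = id_blinfun \<and> T o\<^sub>L S = id_blinfun)"

definition op_inverse :: "('a::real_normed_vector \<Rightarrow>\<^sub>L 'a) \<Rightarrow> 'a \<Rightarrow>\<^sub>L 'a" where
  "op_inverse T = (THE S. S o\<^sub>L T = id_blinfun \<and> T o\<^sub>L S = id_blinfun)"

lemma op_inverse:
  assumes "op_invertible T"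
  shows "op_inverse T o\<^sub>L T = id_blinfun" "T o\<^sub>L op_inverse T = id_blinfun"
proof -
  have "\<exists>!S. S o\<^sub>L T = id_blinfun \<and> T o\<^sub>L S = id_blinfun"
  proof (rule ex_ex1I)
    show "\<exists>S. S o\<^sub>L T = id_blinfun \<and> T o\<^sub>L S = id_blinfun"
      using assms by (simp add: op_invertible_def)
  next
    fix S S' assume S: "S o\<^sub>L T = id_blinfun \<and> T o\<^sub>L S = id_blinfun"
      and S': "S' o\<^sub>L T = id_blinfun \<and> T o\<^sub>L S' = id_blinfun"
    show "S = S'"
    proof (rule blinfun_eqI)
      fix x
      have "S x = S (T (S' x))"
        using S' by (metis blinfun_apply_blinfun_compose id_blinfun.rep_eq)
      also have "\<dots> = S' x"
        using S by (metis blinfun_apply_blinfun_compose id_blinfun.rep_eq)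
      finally show "S x = S' x" .
    qed
  qed
  from theI'[OF this] show "op_inverse T o\<^sub>L T = id_blinfun" "T o\<^sub>L op_inverse T = id_blinfun"
    by (simp_all add: op_inverse_def)
qed

definition op_power :: "('a::real_normed_vector \<Rightarrow>\<^sub>L 'a) \<Rightarrow> nat \<Rightarrow> 'a \<Rightarrow>\<^sub>L 'a" where
  "op_power T m = (((o\<^sub>L) T) ^^ m) id_blinfun"


section \<open>The S-spectrum and the S-resolvent operators\<close>

definition Q_op :: "'n::{finite,linorder} paravector \<Rightarrow> ('v::real_normed_vector, 'n) cop \<Rightarrow> ('v, 'n) cop"
  where "Q_op s T = (T o\<^sub>L T) - (2 * fst s) *\<^sub>R T + (norm s)\<^sup>2 *\<^sub>R id_blinfun"

definition S_spectrum :: "('v::real_normed_vector, 'n::{finite,linorder}) cop \<Rightarrow> 'n paravector set" where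
  "S_spectrum T = {s. \<not> op_invertible (Q_op s T)}"

definition S_resolvent_set :: "('v::real_normed_vector, 'n::{finite,linorder}) cop \<Rightarrow> 'n paravector set"
  where "S_resolvent_set T = - S_spectrum T"

definition star_left_power ::
  "'n::{finite,linorder} paravector \<Rightarrow> ('v::real_normed_vector, 'n) cop \<Rightarrow> nat \<Rightarrow> ('v, 'n) cop" where
  "star_left_power s T m = (\<Sum>k\<le>m. real (m choose k) *\<^sub>R
     (op_power (- T) k o\<^sub>L scalar_op (paravector (cnj_paravector s) ^ (m - k))))"

definition star_right_power ::
  "'n::{finite,linorder} paravector \<Rightarrow> ('v::real_normed_vector, 'n) cop \<Rightarrow> nat \<Rightarrow> ('v, 'n) cop" where
  "star_right_power s T m = (\<Sum>k\<le>m. real (m choose k) *\<^sub>R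
     (scalar_op (paravector (cnj_paravector s) ^ (m - k)) o\<^sub>L op_power (- T) k))"

text \<open>The exponent \<open>m\<close> stands for the power \<open>-m\<close>: \<open>SL m s T\<close> is \<open>S_L^{-m}(s, T)\<close>.\<close>

definition SL ::
  "nat \<Rightarrow> 'n::{finite,linorder} paravector \<Rightarrow> ('v::real_normed_vector, 'n) cop \<Rightarrow> ('v, 'n) cop" where
  "SL m s T = op_power (op_inverse (Q_op s T)) m o\<^sub>L star_left_power s T m"

definition SR ::
  "nat \<Rightarrow> 'n::{finite,linorder} paravector \<Rightarrow> ('v::real_normed_vector, 'n) cop \<Rightarrow> ('v, 'n) cop" where
  "SR m s T = star_right_power s T m o\<^sub>L op_power (op_inverse (Q_op s T)) m"

lemma SL_1: "SL 1 s T = op_inverse (Q_op s T) o\<^sub>L (scalar_op (paravector (cnj_paravector s)) - T)"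
  by (rule blinfun_eqI)
    (simp add: blinfun.bilinear_simps SL_def star_left_power_def op_power_def scalar_op_one)

lemma SR_1: "SR 1 s T = (scalar_op (paravector (cnj_paravector s)) - T) o\<^sub>L op_inverse (Q_op s T)"
  by (rule blinfun_eqI)
    (simp add: blinfun.bilinear_simps SR_def star_right_power_def op_power_def scalar_op_one)

end

theory Submission
  imports Defs
begin

text \<open>
  Write \<open>s = Re z + (Im z) u\<close> with a unit vector \<open>u\<close>, so that \<open>u\<^sup>2 = -1\<close>.  On the complexification
  of \<open>V\<^sub>n\<close> the operator \<open>Q\<^sub>s(T)\<close> factors as \<open>(z - T) (cnj z - T)\<close>; hence \<open>z\<close> lies in the resolvent
  set of \<open>T\<close>, and \<open>(z - T)\<^sup>-\<^sup>m = Q\<^sub>s(T)\<^sup>-\<^sup>m (cnj z - T)\<^sup>m = A + i B\<close> with \<open>A\<close>, \<open>B\<close> commuting with \<open>T\<close>.  Replacing \<open>i\<close>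
  by multiplication with \<open>u\<close> on the right or on the left of \<open>B\<close> turns this into the two
  \<open>S\<close>-resolvent powers, and does so by a bounded linear map that respects products with \<open>N\<close>
  on the other side.  Both series are therefore images of the complex Neumann series
  \<open>\<Sum>m. N\<^sup>m (z - T)\<^sup>-\<^sup>m\<^sup>-\<^sup>1\<close> of \<open>(z - T - N)\<^sup>-\<^sup>1\<close>.  It converges geometrically, by Cauchy estimates
  for powers: \<open>\<parallel>N\<^sup>m\<parallel> \<le> C \<epsilon>\<^sup>m\<close>, and \<open>\<parallel>(z - T)\<^sup>-\<^sup>m\<parallel> \<le> C \<rho>\<^sup>-\<^sup>m\<close> with \<open>\<rho> > \<epsilon>\<close>, uniformly
  for \<open>z\<close> at distance at least \<open>d > \<rho>\<close> from the spectrum of \<open>T\<close>.  The Cauchy estimates are obtained from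
  averages over roots of unity instead of contour integrals.
\<close>

section \<open>Inverses in Banach algebras\<close>

definition is_inverse :: "'a::monoid_mult \<Rightarrow> 'a \<Rightarrow> bool" where
  "is_inverse a b \<longleftrightarrow> a * b = 1 \<and> b * a = 1"

lemma is_inverse_unique: "is_inverse a b \<Longrightarrow> is_inverse a b' \<Longrightarrow> b = b'"
  unfolding is_inverse_def by (metis mult.assoc mult_1_left mult_1_right)

lemma is_inverse_mult:
  assumes "is_inverse a a'" "is_inverse b b'"
  shows "is_inverse (a * b) (b' * a')"
proof -
  have "a * b * (b' * a') = a * (b * b') * a'" "b' * a' * (a * b) = b' * (a' * a) * b"
    by (simp_all only: mult.assoc)
  then show ?thesis using assms by (simp add: is_inverse_def)
qed

lemma is_inverse_commute:
  assumes "is_inverse a b" "a * c = c * a"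
  shows "b * c = c * b"
proof -
  have "b * c = b * (c * a) * b"
    using assms(1) by (simp add: is_inverse_def mult.assoc)
  also have "\<dots> = b * a * c * b"
    by (simp only: assms(2)[symmetric] mult.assoc)
  also have "\<dots> = c * b"
    using assms(1) by (simp add: is_inverse_def)
  finally show ?thesis .
qed

text \<open>Since \<open>x\<close> commutes with \<open>x * y\<close>, it commutes with
  \<open>b\<close>; this makes the left inverse \<open>b * y\<close> a right inverse as
  well.\<close>

lemma is_inverse_commuting_factor:
  assumes "is_inverse (x * y) b" "x * y = y * x"
  shows "is_inverse x (b * y)"
proof -
  have "b * x = x * b"
    by (rule is_inverse_commute[OF assms(1)]) (simp only: mult.assoc assms(2)[symmetric])
  then have "x * (b * y) = b * (x * y)" by (simp add: mult.assoc[symmetric])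
  moreover have "b * y * x = b * (x * y)" by (simp add: assms(2) mult.assoc)
  ultimately show ?thesis using assms(1) by (simp add: is_inverse_def)
qed

lemma power_mult_distrib_commuting:
  fixes a b :: "'a::monoid_mult"
  assumes "a * b = b * a"
  shows "(a * b) ^ m = a ^ m * b ^ m"
proof (induction m)
  case (Suc m)
  have "(a * b) ^ Suc m = a * (b * a ^ m) * b ^ m"
    by (simp add: Suc mult.assoc)
  also have "b * a ^ m = a ^ m * b"
    using power_commuting_commutes[OF assms] by simp
  finally show ?case by (simp add: mult.assoc)
qed simp

lemma power_diff_geometric:
  fixes x :: "'a::{ring, monoid_mult}"
  shows "(\<Sum>i<k. x ^ i) * (1 - x) = 1 - x ^ k" "(1 - x) * (\<Sum>i<k. x ^ i) = 1 - x ^ k"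
proof (induction k)
  case (Suc k)
  case 1
  from Suc show ?case by (simp add: distrib_right) (simp add: algebra_simps power_commutes)
  case 2
  from Suc show ?case by (simp add: distrib_left) (simp add: algebra_simps)
qed simp_all

text \<open>Pascal's rule, with commutativity moving \<open>b\<close> past \<open>a ^ k\<close>. It
  expands powers of \<open>cnj z - T\<close> into the sums that define the star powers.\<close>

lemma binomial_commuting:
  fixes a b :: "'a::{real_algebra, monoid_mult}"
  assumes ab: "a * b = b * a"
  shows "(a + b) ^ m = (\<Sum>k\<le>m. real (m choose k) *\<^sub>R (a ^ k * b ^ (m - k)))"
proof (induction m)
  case 0
  show ?case by simp
next
  case (Suc m)
  let ?g = "\<lambda>k. real (m choose k) *\<^sub>R (a ^ k * b ^ (Suc m - k))"
  have "(a + b) ^ Suc m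
      = (\<Sum>k\<le>m. real (m choose k) *\<^sub>R (a ^ Suc k * b ^ (m - k)))
        + (\<Sum>k\<le>m. real (m choose k) *\<^sub>R (a ^ k * b ^ (Suc m - k)))"
  proof -
    have "b * (a ^ k * b ^ (m - k)) = a ^ k * b ^ (Suc m - k)" if "k \<le> m" for k
    proof -
      have "b * (a ^ k * b ^ (m - k)) = (b * a ^ k) * b ^ (m - k)"
        by (simp add: mult.assoc)
      also have "b * a ^ k = a ^ k * b"
        using power_commuting_commutes[OF ab] by simp
      finally show ?thesis using that by (simp add: Suc_diff_le mult.assoc)
    qed
    then have "(\<Sum>k\<le>m. real (m choose k) *\<^sub>R (b * (a ^ k * b ^ (m - k))))
        = (\<Sum>k\<le>m. real (m choose k) *\<^sub>R (a ^ k * b ^ (Suc m - k)))"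
      by (intro sum.cong) simp_all
    then show ?thesis
      by (simp add: Suc distrib_right sum_distrib_left mult.assoc scaleR_add_right sum.distrib)
  qed
  also have "(\<Sum>k\<le>m. real (m choose k) *\<^sub>R (a ^ k * b ^ (Suc m - k)))
      = b ^ Suc m + (\<Sum>k\<le>m. real (m choose Suc k) *\<^sub>R (a ^ Suc k * b ^ (m - k)))"
    \<comment> \<open>The sum of \<open>?g\<close> may run up to \<open>Suc m\<close>, since
      \<open>m choose Suc m\<close> is 0; shifting its index then splits off
      \<open>b ^ Suc m\<close>.\<close>
    using sum.atMost_Suc_shift[of ?g m] by (simp add: binomial_eq_0 mult.assoc)
  also have "(\<Sum>k\<le>m. real (m choose k) *\<^sub>R (a ^ Suc k * b ^ (m - k))) +
      (b ^ Suc m + (\<Sum>k\<le>m. real (m choose Suc k) *\<^sub>R (a ^ Suc k * b ^ (m - k))))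
      = b ^ Suc m + (\<Sum>k\<le>m. real (Suc m choose Suc k) *\<^sub>R (a ^ Suc k * b ^ (m - k)))"
    by (simp add: sum.distrib algebra_simps)
  also have "\<dots> = (\<Sum>k\<le>Suc m. real (Suc m choose k) *\<^sub>R (a ^ k * b ^ (Suc m - k)))"
    by (subst sum.atMost_Suc_shift) simp
  finally show ?case .
qed

lemma one_minus_mult_eq_one_iff:
  fixes y g :: "'a::{ring, monoid_mult}"
  shows "(1 - y) * g = 1 \<longleftrightarrow> y * g = g - 1"
  by (auto simp: left_diff_distrib algebra_simps)

lemma neumann:
  fixes x :: "'a::{real_normed_algebra, monoid_mult, banach}"
  assumes x: "norm x < 1"
  obtains b where "is_inverse (1 - x) b"
proof -
  \<comment> \<open>The estimate starts at exponent 1, as \<open>norm (x ^ 0)\<close> may exceed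
    1.\<close>
  have np: "norm (x ^ Suc i) \<le> norm x ^ Suc i" for i
  proof (induction i)
    case (Suc i)
    have "norm (x ^ Suc (Suc i)) \<le> norm x * norm (x ^ Suc i)"
      using norm_mult_ineq[of x "x ^ Suc i"] by simp
    also have "\<dots> \<le> norm x * norm x ^ Suc i"
      by (rule mult_left_mono[OF Suc]) simp
    finally show ?case by simp
  qed simp
  have "summable (\<lambda>i. norm x ^ Suc i)"
    using x by (subst summable_Suc_iff) (simp add: summable_geometric)
  then have "summable (\<lambda>i. x ^ Suc i)"
    by (rule summable_comparison_test[rotated]) (use np in blast)
  then have sm: "summable (\<lambda>i. x ^ i)"
    by (subst (asm) summable_Suc_iff)
  then have lim: "(\<lambda>k. \<Sum>i<k. x ^ i) \<longlonglongrightarrow> (\<Sum>i. x ^ i)"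
    by (rule summable_LIMSEQ)
  have lim1: "(\<lambda>k. 1 - x ^ k) \<longlonglongrightarrow> 1"
    using tendsto_diff[OF tendsto_const[of 1] summable_LIMSEQ_zero[OF sm]] by simp
  have "(1 - x) * (\<Sum>i. x ^ i) = 1"
    using tendsto_mult[OF tendsto_const[of "1 - x"] lim] lim1
    by (simp add: power_diff_geometric LIMSEQ_unique)
  moreover have "(\<Sum>i. x ^ i) * (1 - x) = 1"
    using tendsto_mult[OF lim tendsto_const[of "1 - x"]] lim1
    by (simp add: power_diff_geometric LIMSEQ_unique)
  ultimately show ?thesis by (intro that) (simp add: is_inverse_def)
qed

text \<open>Factor \<open>c = a * (1 - x)\<close> with \<open>x = b * (a - c)\<close> and invert the
  second factor by \<open>neumann\<close>. The norm bound is read off the fixed point equation for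
  \<open>y * b\<close>, so that \<open>norm 1\<close> does not enter it.\<close>

lemma is_inverse_perturb:
  fixes a b c :: "'a::{real_normed_algebra, monoid_mult, banach}"
  assumes ab: "is_inverse a b" and small: "norm b * norm (a - c) \<le> 1 / 2"
  obtains d where "is_inverse c d" "norm d \<le> 2 * norm b"
proof -
  define x where "x = b * (a - c)"
  have x: "norm x \<le> 1 / 2"
    unfolding x_def using norm_mult_ineq small by (rule order_trans)
  then obtain y where y: "is_inverse (1 - x) y"
    using neumann[of x] by force
  have c: "c = a * (1 - x)"
  proof -
    have "a * (1 - x) = a - (a * b) * (a - c)"
      by (simp add: x_def algebra_simps)
    then show ?thesis using ab by (simp add: is_inverse_def)
  qed
  have inv: "is_inverse c (y * b)"
    unfolding c by (rule is_inverse_mult[OF ab y])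
  have "y * b = b + x * (y * b)"
  proof -
    have "(1 - x) * (y * b) = b" using y by (simp add: is_inverse_def mult.assoc[symmetric])
    then show ?thesis by (simp add: algebra_simps)
  qed
  then have "norm (y * b) \<le> norm b + norm x * norm (y * b)"
    by (metis norm_triangle_le norm_mult_ineq add_left_mono)
  also have "\<dots> \<le> norm b + 1 / 2 * norm (y * b)"
    by (intro add_left_mono mult_right_mono x) simp
  finally have "norm (y * b) \<le> 2 * norm b" by simp
  with inv that show ?thesis by blast
qed

section \<open>Roots of unity\<close>

lemma cis_roots_of_unity:
  assumes "k > 0"
  shows "cis (2 * pi * real l / real k) ^ k = 1"
proof -
  have "cis (2 * pi * real l / real k) ^ k = cis (2 * pi * real l)"
    unfolding Complex.DeMoivre using assms by simp
  then show ?thesis using cis_multiple_2pi[of "real l"] by simp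
qed

text \<open>The summand is \<open>q ^ j\<close> for the quotient \<open>q\<close> of the roots with
  indices \<open>i\<close> and \<open>m\<close>. This is a \<open>k\<close>-th root of unity,
  different from 1 unless \<open>i = m\<close>, so the geometric sum vanishes.\<close>

lemma sum_roots_of_unity_orthogonal:
  assumes "i < k" "m < k"
  shows "(\<Sum>j<k. inverse (cis (2 * pi * real j / real k)) ^ m * cis (2 * pi * real j / real k) ^ i)
    = (if i = m then of_nat k else 0)"
proof -
  let ?z = "\<lambda>j. cis (2 * pi * real j / real k)"
  define q where "q = ?z i * inverse (?z m)"
  have swap: "?z j ^ l = ?z l ^ j" for j l
  proof -
    have "?z j ^ l = cis (real l * (2 * pi * real j / real k))" by (rule Complex.DeMoivre)
    also have "real l * (2 * pi * real j / real k) = real j * (2 * pi * real l / real k)" by simp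
    also have "cis \<dots> = ?z l ^ j" by (rule Complex.DeMoivre[symmetric])
    finally show ?thesis .
  qed
  have "inverse (?z j) ^ m * ?z j ^ i = q ^ j" for j
    unfolding q_def power_mult_distrib power_inverse by (simp add: swap[of j])
  then have eq: "(\<Sum>j<k. inverse (?z j) ^ m * ?z j ^ i) = (\<Sum>j<k. q ^ j)"
    by simp
  show ?thesis
  proof (cases "i = m")
    case True
    then have "q = 1" by (simp add: q_def del: cis_inverse)
    with True show ?thesis using eq by simp
  next
    case False
    have "inj_on ?z {..<k}"
      using Complex.bij_betw_roots_unity[of k] assms by (auto simp: bij_betw_def)
    then have "?z i \<noteq> ?z m" using False assms by (auto simp: inj_on_def)
    then have "q \<noteq> 1" by (simp add: q_def field_simps)
    moreover have "q ^ k = 1"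
    proof -
      have "?z l ^ k = 1" for l
        using assms by (intro cis_roots_of_unity) simp
      then show ?thesis by (simp add: q_def power_mult_distrib power_inverse del: cis_inverse)
    qed
    ultimately show ?thesis using eq False by (simp add: geometric_sum)
  qed
qed

section \<open>Resolvents in a real Banach algebra with an imaginary unit\<close>

locale complex_structure =
  fixes J :: "'a::{real_normed_algebra, monoid_mult, banach}"
  assumes J_squared: "J * J = - 1"
begin

text \<open>\<open>J\<close> need not be central, so the algebra is not assumed to be complex; and neither
  \<open>norm 1 = 1\<close> nor \<open>1 \<noteq> 0\<close> is available, since the module \<open>V\<close> may be trivial.\<close>

definition e :: "complex \<Rightarrow> 'a" where
  "e c = Re c *\<^sub>R 1 + Im c *\<^sub>R J"

definition K :: real where
  "K = norm (1::'a) + norm J"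

lemma e_of_real: "e (of_real r) = r *\<^sub>R 1" and e_1 [simp]: "e 1 = 1" and e_0 [simp]: "e 0 = 0"
  by (simp_all add: e_def)

lemma e_add: "e (c + d) = e c + e d" and e_diff: "e (c - d) = e c - e d"
  by (simp_all add: e_def algebra_simps)

lemma e_sum: "e (\<Sum>i\<in>I. f i) = (\<Sum>i\<in>I. e (f i))"
  by (induction I rule: infinite_finite_induct) (simp_all add: e_add)

lemma e_mult: "e (c * d) = e c * e d"
  by (simp add: e_def algebra_simps J_squared)

lemma e_power: "e (c ^ m) = e c ^ m"
  by (induction m) (simp_all add: e_mult)

lemma e_commute: "J * x = x * J \<Longrightarrow> e c * x = x * e c"
  by (simp add: e_def algebra_simps)

lemma J_commute_e: "J * e c = e c * J"
  by (simp add: e_def algebra_simps)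

lemma is_inverse_e: "c \<noteq> 0 \<Longrightarrow> is_inverse (e c) (e (inverse c))"
  by (simp add: is_inverse_def e_mult[symmetric])

lemma K_nonneg [simp]: "K \<ge> 0"
  by (simp add: K_def)

lemma norm_e_le: "norm (e c) \<le> K * cmod c"
proof -
  have "norm (e c) \<le> \<bar>Re c\<bar> * norm (1::'a) + \<bar>Im c\<bar> * norm J"
    unfolding e_def by (rule norm_triangle_le) simp
  also have "\<dots> \<le> cmod c * norm (1::'a) + cmod c * norm J"
    by (intro add_mono mult_right_mono abs_Re_le_cmod abs_Im_le_cmod) auto
  finally show ?thesis by (simp add: K_def algebra_simps)
qed

lemma norm_e_mult_le: "norm (e c * x) \<le> K * cmod c * norm x"
  by (rule order_trans[OF norm_mult_ineq mult_right_mono[OF norm_e_le]]) simp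

section \<open>Uniform bounds for the resolvent\<close>

text \<open>Each inverse bounds the inverses at nearby points by \<open>is_inverse_perturb\<close>;
  compactness leaves finitely many centres, over which the bounds are summed.\<close>

lemma resolvent_bounded_on_compact:
  assumes D: "compact D" and inv: "\<And>w. w \<in> D \<Longrightarrow> \<exists>b. is_inverse (e w - a) b"
  shows "\<exists>M. \<forall>w\<in>D. \<forall>b. is_inverse (e w - a) b \<longrightarrow> norm b \<le> M"
proof -
  obtain R where R: "\<And>w. w \<in> D \<Longrightarrow> is_inverse (e w - a) (R w)"
    using inv by metis
  \<comment> \<open>Within this radius of \<open>w\<close> the perturbation has size at most
    \<open>K * ?r w\<close>, and \<open>norm (R w) * (K * ?r w) \<le> 1 / 2\<close>. The summand 1
    keeps the denominator positive.\<close>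
  let ?r = "\<lambda>w. 1 / (2 * K * norm (R w) + 1)"
  have pos: "0 < 2 * K * norm (R w) + 1" for w
    by (intro add_nonneg_pos mult_nonneg_nonneg) auto
  obtain F where F: "F \<subseteq> D" "finite F" "D \<subseteq> (\<Union>w\<in>F. ball w (?r w))"
    by (rule compactE_image[OF D, of D "\<lambda>w. ball w (?r w)"]) (use pos in auto)
  have "norm b \<le> (\<Sum>w\<in>F. 2 * norm (R w))" if w: "w \<in> D" "is_inverse (e w - a) b" for w b
  proof -
    from w F obtain v where v: "v \<in> F" "dist v w < ?r v" by auto
    have "norm (R v) * norm (e v - a - (e w - a)) \<le> norm (R v) * (K * ?r v)"
    proof (intro mult_left_mono)
      have "norm (e v - a - (e w - a)) \<le> K * cmod (v - w)"
        using norm_e_le[of "v - w"] by (simp add: e_diff)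
      also have "\<dots> \<le> K * ?r v"
        using v(2) by (intro mult_left_mono) (auto simp: dist_norm)
      finally show "norm (e v - a - (e w - a)) \<le> K * ?r v" .
    qed simp
    also have "\<dots> \<le> 1 / 2"
      using pos[of v] by (simp add: field_simps)
    finally obtain d where d: "is_inverse (e w - a) d" "norm d \<le> 2 * norm (R v)"
      using is_inverse_perturb[OF R] v(1) F(1) by blast
    then have "norm b \<le> 2 * norm (R v)"
      using is_inverse_unique[OF w(2)] by auto
    also have "\<dots> \<le> (\<Sum>w\<in>F. 2 * norm (R w))"
      by (rule member_le_sum[OF v(1)]) (use F in auto)
    finally show ?thesis .
  qed
  then show ?thesis by blast
qed

text \<open>Here \<open>e w - a\<close> is a perturbation of \<open>e w\<close>, whose inverse has
  norm at most \<open>K / cmod w\<close>. The threshold makes the perturbation small enough and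
  ensures \<open>cmod w \<ge> 1\<close>.\<close>

lemma resolvent_bounded_near_infinity:
  assumes w: "cmod w \<ge> 2 * K * norm a + 1" and b: "is_inverse (e w - a) b"
  shows "norm b \<le> 2 * K"
proof -
  have p: "0 \<le> 2 * K * norm a" by (intro mult_nonneg_nonneg) auto
  with w have w1: "cmod w \<ge> 1" by linarith
  then have w0: "w \<noteq> 0" by auto
  have le: "norm (e (inverse w)) \<le> K / cmod w"
    using norm_e_le[of "inverse w"] by (simp add: norm_inverse divide_inverse)
  have "norm (e (inverse w)) * norm (e w - (e w - a)) \<le> K / cmod w * norm a"
    using le by (intro mult_mono) auto
  also have "\<dots> \<le> 1 / 2"
  proof -
    have "cmod w > 0" using w1 by linarith
    with w show ?thesis by (simp add: divide_le_eq_1_pos mult_ac)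
  qed
  finally obtain d where d: "is_inverse (e w - a) d" "norm d \<le> 2 * norm (e (inverse w))"
    using is_inverse_perturb[OF is_inverse_e[OF w0]] by blast
  have "K / cmod w \<le> K / 1" using w1 by (intro divide_left_mono) auto
  then show ?thesis using d le is_inverse_unique[OF b] by fastforce
qed

lemma resolvent_bounded_on_closed:
  assumes D: "closed D" and inv: "\<And>w. w \<in> D \<Longrightarrow> \<exists>b. is_inverse (e w - a) b"
  obtains M where "M \<ge> 0" "\<And>w b. w \<in> D \<Longrightarrow> is_inverse (e w - a) b \<Longrightarrow> norm b \<le> M"
proof -
  have "compact (D \<inter> cball 0 (2 * K * norm a + 1))"
    using D by (simp add: closed_Int_compact)
  then obtain M where M: "\<forall>w\<in>D \<inter> cball 0 (2 * K * norm a + 1). \<forall>b. is_inverse (e w - a) b \<longrightarrow> norm b \<le> M"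
    using resolvent_bounded_on_compact[of "D \<inter> cball 0 (2 * K * norm a + 1)" a] inv by auto
  show ?thesis
  proof (rule that[of "max M (2 * K)"])
    fix w b assume w: "w \<in> D" and b: "is_inverse (e w - a) b"
    show "norm b \<le> max M (2 * K)"
    proof (cases "cmod w \<le> 2 * K * norm a + 1")
      case True
      then have "norm b \<le> M" using M w b by auto
      then show ?thesis by simp
    next
      case False
      then have "norm b \<le> 2 * K" using resolvent_bounded_near_infinity[OF _ b] by simp
      then show ?thesis by simp
    qed
  qed (use K_nonneg in linarith)
qed

section \<open>Averages over roots of unity and Cauchy estimates\<close>

text \<open>A discrete Cauchy integral: the \<open>k\<close>-point quadrature on the circle of
  radius \<open>t\<close> for \<open>t ^ m\<close> times the \<open>m\<close>-th Taylor coefficient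
  of \<open>f\<close>.\<close>

definition root_average :: "(complex \<Rightarrow> 'a) \<Rightarrow> nat \<Rightarrow> nat \<Rightarrow> real \<Rightarrow> 'a" where
  "root_average f k m t = (1 / real k) *\<^sub>R (\<Sum>j<k.
     e (inverse (cis (2 * pi * real j / real k)) ^ m) * f (cis (2 * pi * real j / real k) * of_real t))"

text \<open>At the sample points \<open>w ^ k = t ^ k\<close>, so multiplying the inverse of
  \<open>1 - x\<close> by \<open>1 - x ^ k\<close> leaves a finite geometric sum. Orthogonality
  selects the term \<open>i = m\<close>; the quadrature error is exactly the factor
  \<open>1 - t ^ k *\<^sub>R a ^ k\<close>.\<close>

lemma root_average_eq:
  assumes aJ: "J * a = a * J" and mk: "m < k"
    and f: "\<And>w. cmod w = \<bar>t\<bar> \<Longrightarrow> is_inverse (1 - e w * a) (f w)"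
  shows "(1 - t ^ k *\<^sub>R a ^ k) * root_average f k m t = t ^ m *\<^sub>R a ^ m"
proof -
  let ?z = "\<lambda>j. cis (2 * pi * real j / real k)"
  let ?c = "\<lambda>j. inverse (?z j) ^ m"
  have pow: "(e w * a) ^ i = e (w ^ i) * a ^ i" for w i
    unfolding e_power by (rule power_mult_distrib_commuting[OF e_commute[OF aJ]])
  have summand: "(1 - t ^ k *\<^sub>R a ^ k) * (e (?c j) * f (?z j * of_real t))
      = (\<Sum>i<k. e ((?c j * ?z j ^ i) * of_real (t ^ i)) * a ^ i)" for j
  proof -
    define w where "w = ?z j * of_real t"
    define x where "x = e w * a"
    have inv: "(1 - x) * f w = 1"
      using f[of w] by (simp add: x_def w_def norm_mult is_inverse_def)
    have "?z j ^ k = 1"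
      using mk by (intro cis_roots_of_unity) simp
    then have "w ^ k = of_real (t ^ k)"
      by (simp add: w_def power_mult_distrib)
    then have xk: "x ^ k = t ^ k *\<^sub>R a ^ k"
      by (simp add: x_def pow e_of_real del: of_real_power)
    have "J * a ^ i = a ^ i * J" for i
      using power_commuting_commutes[OF aJ[symmetric]] by simp
    then have comm: "(1 - t ^ k *\<^sub>R a ^ k) * e (?c j) = e (?c j) * (1 - t ^ k *\<^sub>R a ^ k)"
      by (simp add: algebra_simps e_commute)
    have "(1 - t ^ k *\<^sub>R a ^ k) * (e (?c j) * f w) = e (?c j) * ((1 - x ^ k) * f w)"
      by (simp only: mult.assoc[symmetric] comm xk)
    also have "(1 - x ^ k) * f w = (\<Sum>i<k. x ^ i) * ((1 - x) * f w)"
      by (simp only: power_diff_geometric(1)[symmetric] mult.assoc)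
    also have "\<dots> = (\<Sum>i<k. e (w ^ i) * a ^ i)"
      by (simp add: inv) (simp add: x_def pow)
    also have "e (?c j) * \<dots> = (\<Sum>i<k. e (?c j * w ^ i) * a ^ i)"
      by (simp add: sum_distrib_left e_mult mult.assoc)
    finally show ?thesis
      by (simp add: w_def power_mult_distrib mult.assoc)
  qed
  have "(1 - t ^ k *\<^sub>R a ^ k) * root_average f k m t
      = (1 / real k) *\<^sub>R (\<Sum>j<k. (1 - t ^ k *\<^sub>R a ^ k) * (e (?c j) * f (?z j * of_real t)))"
    by (simp add: root_average_def sum_distrib_left)
  also have "(\<Sum>j<k. (1 - t ^ k *\<^sub>R a ^ k) * (e (?c j) * f (?z j * of_real t)))
      = (\<Sum>i<k. \<Sum>j<k. e ((?c j * ?z j ^ i) * of_real (t ^ i)) * a ^ i)"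
    unfolding summand by (rule sum.swap)
  also have "\<dots> = (\<Sum>i<k. e ((\<Sum>j<k. ?c j * ?z j ^ i) * of_real (t ^ i)) * a ^ i)"
    by (simp only: sum_distrib_right e_sum)
  also have "\<dots> = (\<Sum>i<k. if i = m then (real k * t ^ m) *\<^sub>R a ^ m else 0)"
  proof (rule sum.cong[OF refl])
    fix i assume "i \<in> {..<k}"
    then have "(\<Sum>j<k. ?c j * ?z j ^ i) = (if i = m then of_nat k else 0)"
      using sum_roots_of_unity_orthogonal[of i k m] mk by simp
    moreover have "e (of_nat k * of_real (t ^ m)) = (real k * t ^ m) *\<^sub>R 1"
      using e_of_real[of "real k * t ^ m"] by simp
    ultimately show "e ((\<Sum>j<k. ?c j * ?z j ^ i) * of_real (t ^ i)) * a ^ i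
        = (if i = m then (real k * t ^ m) *\<^sub>R a ^ m else 0)"
      by simp
  qed
  also have "(1 / real k) *\<^sub>R \<dots> = t ^ m *\<^sub>R a ^ m"
    using mk by simp
  finally show ?thesis .
qed

lemma norm_average_le:
  assumes "k > 0" and "\<And>j. j < k \<Longrightarrow> norm (g j) \<le> B"
  shows "norm ((1 / real k) *\<^sub>R (\<Sum>j<k. g j :: 'a)) \<le> B"
proof -
  have "norm (\<Sum>j<k. g j) \<le> (\<Sum>j<k. B)"
    by (rule sum_norm_le) (use assms in auto)
  then show ?thesis using assms(1) by (simp add: field_simps)
qed

lemma norm_root_average_le:
  assumes k: "k > 0" and f: "\<And>w. cmod w = \<bar>t\<bar> \<Longrightarrow> norm (f w) \<le> M"
  shows "norm (root_average f k m t) \<le> K * M"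
  unfolding root_average_def
proof (rule norm_average_le[OF k])
  fix j
  let ?z = "cis (2 * pi * real j / real k)"
  have "norm (e (inverse ?z ^ m) * f (?z * of_real t)) \<le> K * cmod (inverse ?z ^ m) * norm (f (?z * of_real t))"
    by (rule norm_e_mult_le)
  also have "\<dots> \<le> K * 1 * M"
    by (intro mult_mono f) (auto simp: norm_power norm_inverse norm_mult)
  finally show "norm (e (inverse ?z ^ m) * f (?z * of_real t)) \<le> K * M" by simp
qed

text \<open>The factor \<open>1 - t\<^sup>k a\<^sup>k\<close> in the averaged identity is controlled by continuation in \<open>t\<close>:
  as the averages are Lipschitz in \<open>t\<close> with a constant that does not depend on \<open>k\<close>,
  the convergence \<open>t\<^sup>k a\<^sup>k \<longlonglongrightarrow> 0\<close> propagates from \<open>t\<close> by a fixed step.\<close>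

lemma root_average_lipschitz:
  assumes k: "k > 0" and M: "M \<ge> 0"
    and f: "\<And>w. cmod w \<le> \<rho> \<Longrightarrow> is_inverse (1 - e w * a) (f w)"
    and fM: "\<And>w. cmod w \<le> \<rho> \<Longrightarrow> norm (f w) \<le> M"
    and t: "0 \<le> t" "t \<le> \<rho>" "0 \<le> t'" "t' \<le> \<rho>"
  shows "norm (root_average f k 0 t - root_average f k 0 t') \<le> M * (K * norm a) * M * \<bar>t - t'\<bar>"
proof -
  let ?z = "\<lambda>j. cis (2 * pi * real j / real k)"
  \<comment> \<open>The resolvent identity, which exposes the small factor
    \<open>e (w - w')\<close>.\<close>
  have f_diff: "f w - f w' = f w * (e (w - w') * a) * f w'" if "cmod w \<le> \<rho>" "cmod w' \<le> \<rho>" for w w'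
  proof -
    have "e (w - w') * a = (1 - e w' * a) - (1 - e w * a)"
      by (simp add: e_diff algebra_simps)
    then have "f w * (e (w - w') * a) * f w'
        = f w * ((1 - e w' * a) * f w') - (f w * (1 - e w * a)) * f w'"
      by (simp only: right_diff_distrib left_diff_distrib mult.assoc)
    then show ?thesis
      using f[OF that(1)] f[OF that(2)] by (simp add: is_inverse_def)
  qed
  have "root_average f k 0 t - root_average f k 0 t'
      = (1 / real k) *\<^sub>R (\<Sum>j<k. f (?z j * of_real t) - f (?z j * of_real t'))"
    by (simp add: root_average_def sum_subtractf scaleR_diff_right)
  also have "norm \<dots> \<le> M * (K * norm a) * M * \<bar>t - t'\<bar>"
  proof (rule norm_average_le[OF k])
    fix j
    let ?w = "?z j * of_real t" and ?w' = "?z j * of_real t'"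
    have w: "cmod ?w \<le> \<rho>" "cmod ?w' \<le> \<rho>"
      using t by (simp_all add: norm_mult)
    have "cmod (?w - ?w') = \<bar>t - t'\<bar>"
      unfolding right_diff_distrib[symmetric] of_real_diff[symmetric] norm_mult
      by (simp del: of_real_diff)
    then have ea: "norm (e (?w - ?w') * a) \<le> K * \<bar>t - t'\<bar> * norm a"
      using norm_e_mult_le[of "?w - ?w'" a] by simp
    have "norm (f ?w * (e (?w - ?w') * a) * f ?w') \<le> norm (f ?w) * norm (e (?w - ?w') * a) * norm (f ?w')"
      by (meson norm_mult_ineq mult_right_mono norm_ge_zero order_trans)
    also have "\<dots> \<le> M * (K * \<bar>t - t'\<bar> * norm a) * M"
      using M by (intro mult_mono fM w ea) auto
    finally show "norm (f ?w - f ?w') \<le> M * (K * norm a) * M * \<bar>t - t'\<bar>"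
      by (simp only: f_diff[OF w]) (simp add: mult_ac)
  qed
  finally show ?thesis .
qed

text \<open>For \<open>m = 0\<close> the averaged identity reads \<open>(1 - y) * g = 1\<close> with
  \<open>y\<close> the scaled power. At \<open>t\<close> and large \<open>k\<close>,
  \<open>y\<close> is small, so \<open>g\<close> is within 1/4 of 1; the Lipschitz bound keeps it
  within 1/2 of 1 at \<open>t'\<close>, which forces \<open>norm y \<le> 1\<close> there. Every
  smaller \<open>t''\<close> then gains the decaying factor \<open>(t'' / t') ^ k\<close>.\<close>

lemma scaled_powers_tendsto_0_step:
  assumes aJ: "J * a = a * J" and M: "M \<ge> 0"
    and f: "\<And>w. cmod w \<le> \<rho> \<Longrightarrow> is_inverse (1 - e w * a) (f w)"
    and fM: "\<And>w. cmod w \<le> \<rho> \<Longrightarrow> norm (f w) \<le> M"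
    and t: "0 \<le> t" "t \<le> t'" "t' \<le> \<rho>" "M * (K * norm a) * M * (t' - t) \<le> 1 / 4"
    and lim: "(\<lambda>k. t ^ k *\<^sub>R a ^ k) \<longlonglongrightarrow> 0"
    and t'': "0 \<le> t''" "t'' < t'"
  shows "(\<lambda>k. t'' ^ k *\<^sub>R a ^ k) \<longlonglongrightarrow> 0"
proof -
  let ?g = "\<lambda>k. root_average f k 0"
  have id: "(1 - u ^ k *\<^sub>R a ^ k) * ?g k u = 1" if "0 \<le> u" "u \<le> \<rho>" "k > 0" for u k
    using root_average_eq[OF aJ that(3), of u f] f that by simp
  have bnd: "norm (?g k u) \<le> K * M" if "0 \<le> u" "u \<le> \<rho>" "k > 0" for u k
    using norm_root_average_le[of k u f M 0] fM that by simp
  have "(\<lambda>k. norm (t ^ k *\<^sub>R a ^ k) * (K * M)) \<longlonglongrightarrow> 0"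
    using tendsto_mult_left_zero[OF tendsto_norm_zero[OF lim]] by blast
  then have "eventually (\<lambda>k. norm (t ^ k *\<^sub>R a ^ k) * (K * M) < 1 / 4) sequentially"
    by (rule order_tendstoD) simp
  then have ev: "eventually (\<lambda>k. norm (t' ^ k *\<^sub>R a ^ k) \<le> 1) sequentially"
    using eventually_gt_at_top[of 0]
  proof eventually_elim
    case (elim k)
    let ?y = "t' ^ k *\<^sub>R a ^ k"
    have u: "0 \<le> t" "t \<le> \<rho>" "0 \<le> t'" "t' \<le> \<rho>" using t by auto
    have "?g k t - 1 = (t ^ k *\<^sub>R a ^ k) * ?g k t"
      using id[OF u(1,2) elim(2)] by (simp only: one_minus_mult_eq_one_iff)
    then have "norm (?g k t - 1) \<le> norm (t ^ k *\<^sub>R a ^ k) * norm (?g k t)"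
      by (metis norm_mult_ineq)
    also have "\<dots> \<le> norm (t ^ k *\<^sub>R a ^ k) * (K * M)"
      by (intro mult_left_mono bnd u elim) simp
    finally have "norm (?g k t - 1) \<le> 1 / 4" using elim by linarith
    moreover have "norm (?g k t' - ?g k t) \<le> 1 / 4"
      using root_average_lipschitz[OF elim(2) M f fM u(3,4,1,2)] t by simp
    ultimately have g: "norm (?g k t' - 1) \<le> 1 / 2"
      using norm_triangle_ineq[of "?g k t' - ?g k t" "?g k t - 1"] by simp
    have "?y * ?g k t' = ?g k t' - 1"
      using id[OF u(3,4) elim(2)] by (simp only: one_minus_mult_eq_one_iff)
    \<comment> \<open>As \<open>norm (?g k t' - 1) \<le> 1 / 2\<close>, the second term can be
      absorbed into the left-hand side.\<close>
    then have "?y = (?g k t' - 1) - ?y * (?g k t' - 1)"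
      by (simp add: right_diff_distrib)
    then have "norm ?y \<le> norm (?g k t' - 1) + norm (?y * (?g k t' - 1))"
      by (metis norm_triangle_ineq4)
    also have "\<dots> \<le> 1 / 2 + norm ?y * (1 / 2)"
      by (intro add_mono g order_trans[OF norm_mult_ineq mult_left_mono]) auto
    finally show ?case by simp
  qed
  have t'0: "t' > 0" using t'' by linarith
  have lim0: "(\<lambda>k. (t'' / t') ^ k) \<longlonglongrightarrow> 0"
    using t'' t'0 by (intro LIMSEQ_power_zero) (simp add: abs_of_pos)
  show ?thesis
  proof (rule Lim_null_comparison[OF _ lim0])
    show "eventually (\<lambda>k. norm (t'' ^ k *\<^sub>R a ^ k) \<le> (t'' / t') ^ k) sequentially"
      using ev
    proof eventually_elim
      case (elim k)
      have "norm (t'' ^ k *\<^sub>R a ^ k) = (t'' / t') ^ k * norm (t' ^ k *\<^sub>R a ^ k)"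
        using t'' t'0 by (simp add: power_divide)
      also have "\<dots> \<le> (t'' / t') ^ k * 1"
        using elim t'' t'0 by (intro mult_left_mono) auto
      finally show ?case by simp
    qed
  qed
qed

text \<open>Cauchy estimate for the coefficients of the inverse of \<open>1 - e w * a\<close>.
  Finitely many continuation steps from 0 give convergence of the scaled powers to 0 for each
  \<open>t < \<rho>\<close>; letting \<open>k\<close> tend to infinity in
  \<open>root_average_eq\<close> bounds \<open>t ^ m * norm (a ^ m)\<close>, and finally
  \<open>t\<close> tends to \<open>\<rho>\<close>.\<close>

lemma norm_power_le_of_inverse_bound:
  assumes aJ: "J * a = a * J" and \<rho>: "\<rho> > 0" and M: "M \<ge> 0"
    and f: "\<And>w. cmod w \<le> \<rho> \<Longrightarrow> is_inverse (1 - e w * a) (f w)"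
    and fM: "\<And>w. cmod w \<le> \<rho> \<Longrightarrow> norm (f w) \<le> M"
  shows "norm (a ^ m) \<le> K * M / \<rho> ^ m"
proof -
  \<comment> \<open>Over a step of length \<open>\<delta>\<close> the averages vary by at most 1/4,
    wherever the step starts.\<close>
  define \<delta> where "\<delta> = 1 / (4 * (M * (K * norm a) * M) + 1)"
  have L: "0 \<le> M * (K * norm a) * M" using M by (intro mult_nonneg_nonneg) auto
  then have \<delta>: "\<delta> > 0" "M * (K * norm a) * M * \<delta> \<le> 1 / 4"
    by (auto simp: \<delta>_def field_simps)
  have step: "\<forall>t. 0 \<le> t \<and> t < \<rho> \<and> t \<le> real i * (\<delta> / 2) \<longrightarrow> (\<lambda>k. t ^ k *\<^sub>R a ^ k) \<longlonglongrightarrow> 0" for i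
  proof (induction i)
    case 0
    have "eventually (\<lambda>k. (0::real) ^ k *\<^sub>R a ^ k = 0) sequentially"
      using eventually_gt_at_top[of 0] by eventually_elim simp
    then have "(\<lambda>k. (0::real) ^ k *\<^sub>R a ^ k) \<longlonglongrightarrow> 0"
      by (rule tendsto_eventually)
    then show ?case by auto
  next
    case (Suc i)
    show ?case
    proof (intro allI impI)
      fix t assume t: "0 \<le> t \<and> t < \<rho> \<and> t \<le> real (Suc i) * (\<delta> / 2)"
      \<comment> \<open>Stepping back by only half of \<open>\<delta>\<close> leaves
        \<open>t\<close> strictly below \<open>t'\<close>, as the step lemma requires.\<close>
      define s where "s = max 0 (t - \<delta> / 2)"
      define t' where "t' = min \<rho> (s + \<delta>)"
      have s: "0 \<le> s" "s \<le> t" "s \<le> real i * (\<delta> / 2)" "t < s + \<delta>"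
        using t \<delta> mult_nonneg_nonneg[of "real i" "\<delta> / 2"]
        by (auto simp: s_def max_def algebra_simps)
      have "(\<lambda>k. s ^ k *\<^sub>R a ^ k) \<longlonglongrightarrow> 0"
        using Suc s t by auto
      moreover have "M * (K * norm a) * M * (t' - s) \<le> M * (K * norm a) * M * \<delta>"
        by (intro mult_left_mono L) (simp add: t'_def)
      ultimately show "(\<lambda>k. t ^ k *\<^sub>R a ^ k) \<longlonglongrightarrow> 0"
        using s t \<delta> by (intro scaled_powers_tendsto_0_step[OF aJ M f fM, of \<rho> s t' t])
          (auto simp: t'_def)
    qed
  qed
  have scaled: "t ^ m * norm (a ^ m) \<le> K * M" if t: "0 \<le> t" "t < \<rho>" for t
  proof -
    obtain i where "t / (\<delta> / 2) \<le> real i"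
      using real_arch_simple by blast
    then have "t \<le> real i * (\<delta> / 2)" using \<delta> by (simp add: field_simps)
    then have lim: "(\<lambda>k. t ^ k *\<^sub>R a ^ k) \<longlonglongrightarrow> 0" using step t by blast
    have "(\<lambda>k. (1 + norm (t ^ k *\<^sub>R a ^ k)) * (K * M)) \<longlonglongrightarrow> (1 + 0) * (K * M)"
      by (intro tendsto_intros tendsto_norm_zero lim)
    moreover have "eventually (\<lambda>k. t ^ m * norm (a ^ m) \<le> (1 + norm (t ^ k *\<^sub>R a ^ k)) * (K * M)) sequentially"
      using eventually_gt_at_top[of m]
    proof eventually_elim
      case (elim k)
      let ?g = "root_average f k m t"
      have "t ^ m * norm (a ^ m) = norm ((1 - t ^ k *\<^sub>R a ^ k) * ?g)"
        using root_average_eq[OF aJ elim, of t f] f t by simp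
      also have "\<dots> \<le> norm ?g + norm (t ^ k *\<^sub>R a ^ k) * norm ?g"
        unfolding left_diff_distrib mult_1_left
        by (meson norm_triangle_ineq4 norm_mult_ineq add_left_mono order_trans)
      also have "\<dots> = (1 + norm (t ^ k *\<^sub>R a ^ k)) * norm ?g"
        by (simp add: distrib_right)
      also have "\<dots> \<le> (1 + norm (t ^ k *\<^sub>R a ^ k)) * (K * M)"
        using norm_root_average_le[of k t f M m] fM t elim by (intro mult_left_mono) auto
      finally show ?case .
    qed
    ultimately show ?thesis
      using tendsto_lowerbound by fastforce
  qed
  have "((\<lambda>t. t ^ m * norm (a ^ m)) \<longlongrightarrow> \<rho> ^ m * norm (a ^ m)) (at_left \<rho>)"
    by (intro tendsto_intros)
  moreover have "eventually (\<lambda>t. t ^ m * norm (a ^ m) \<le> K * M) (at_left \<rho>)"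
    using eventually_at_left_real[OF \<rho>] by eventually_elim (use scaled in auto)
  ultimately have "\<rho> ^ m * norm (a ^ m) \<le> K * M"
    by (rule tendsto_upperbound) simp
  then show ?thesis using \<rho> by (simp add: field_simps)
qed

section \<open>Geometric growth of powers and the Neumann series\<close>

text \<open>For \<open>u \<noteq> 0\<close> and \<open>w = inverse u\<close>,
  \<open>1 - e u * n = e u * (e w - n)\<close>. The disc \<open>cmod u \<le> 1 / \<epsilon>\<close>
  thus corresponds to the region \<open>cmod w \<ge> \<epsilon>\<close>, and the Cauchy estimate
  applies on it.\<close>

lemma norm_power_le_of_spectrum_in_ball:
  assumes Jn: "J * n = n * J" and \<epsilon>: "\<epsilon> > 0"
    and inv: "\<And>w. cmod w \<ge> \<epsilon> \<Longrightarrow> \<exists>b. is_inverse (e w - n) b"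
  obtains C where "C \<ge> 0" "\<And>m. norm (n ^ m) \<le> C * \<epsilon> ^ m"
proof -
  obtain R where R: "\<And>w. cmod w \<ge> \<epsilon> \<Longrightarrow> is_inverse (e w - n) (R w)"
    using inv by metis
  have "closed {w. cmod w \<ge> \<epsilon>}"
    by (intro closed_Collect_le continuous_intros)
  then obtain M where "M \<ge> 0" "\<And>w b. w \<in> {w. cmod w \<ge> \<epsilon>} \<Longrightarrow> is_inverse (e w - n) b \<Longrightarrow> norm b \<le> M"
    by (rule resolvent_bounded_on_closed) (use inv in auto)
  then have M: "M \<ge> 0" "\<And>w. cmod w \<ge> \<epsilon> \<Longrightarrow> norm (R w) \<le> M"
    using R by auto
  \<comment> \<open>The value at \<open>u = 0\<close> belongs to \<open>w\<close> at infinity, where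
    \<open>1 - e u * n\<close> is 1.\<close>
  define f where "f u = (if u = 0 then 1 else R (inverse u) * e (inverse u))" for u
  have far: "cmod (inverse u) \<ge> \<epsilon>" if "u \<noteq> 0" "cmod u \<le> 1 / \<epsilon>" for u
  proof -
    have "cmod u > 0" using that by simp
    then show ?thesis using that \<epsilon> by (simp add: norm_inverse norm_divide field_simps del: zero_less_norm_iff)
  qed
  have f: "is_inverse (1 - e u * n) (f u)" if u: "cmod u \<le> 1 / \<epsilon>" for u
  proof (cases "u = 0")
    case False
    have "1 - e u * n = e u * (e (inverse u) - n)"
      using False by (simp add: right_diff_distrib e_mult[symmetric])
    then show ?thesis
      using is_inverse_mult[OF is_inverse_e[OF False] R[OF far[OF False u]]] False
      by (simp add: f_def)
  qed (simp add: f_def is_inverse_def)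
  have fM: "norm (f u) \<le> norm (1::'a) + M * norm n" if u: "cmod u \<le> 1 / \<epsilon>" for u
  proof (cases "u = 0")
    case False
    note w = far[OF False u]
    \<comment> \<open>\<open>e (inverse u)\<close> is unbounded near \<open>u = 0\<close>; the
      right-hand side is bounded.\<close>
    have "R (inverse u) * e (inverse u) = 1 + R (inverse u) * n"
      using R[OF w] by (simp add: is_inverse_def right_diff_distrib diff_eq_eq)
    then have "norm (f u) \<le> norm (1::'a) + norm (R (inverse u) * n)"
      using False by (simp add: f_def norm_triangle_ineq)
    also have "norm (R (inverse u) * n) \<le> M * norm n"
      using norm_mult_ineq M(2)[OF w] by (rule order_trans[OF _ mult_right_mono]) simp
    finally show ?thesis by simp
  qed (simp add: f_def M)
  have "norm (n ^ m) \<le> K * (norm (1::'a) + M * norm n) / (1 / \<epsilon>) ^ m" for m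
    by (rule norm_power_le_of_inverse_bound[OF Jn _ _ f fM]) (use \<epsilon> M in auto)
  then show ?thesis
    using M \<epsilon> by (intro that[of "K * (norm (1::'a) + M * norm n)"]) (simp_all add: power_divide)
qed

text \<open>With \<open>b\<close> the inverse of \<open>e z - a\<close>,
  \<open>1 - e w * b = (e (z - w) - a) * b\<close>, whose inverse is
  \<open>(e z - a) * R (z - w)\<close>. For \<open>cmod w \<le> \<rho>\<close> the point
  \<open>z - w\<close> keeps distance \<open>d - \<rho>\<close> from the spectrum, so the Cauchy
  estimate applies to \<open>b\<close>.\<close>

lemma norm_resolvent_power_le:
  assumes Ja: "J * a = a * J" and \<rho>: "0 < \<rho>" "\<rho> < d"
  obtains C where "C \<ge> 0"
    "\<And>z b m. (\<forall>v. cmod (v - z) < d \<longrightarrow> (\<exists>b. is_inverse (e v - a) b)) \<Longrightarrow>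
      is_inverse (e z - a) b \<Longrightarrow> norm (b ^ m) \<le> C / \<rho> ^ m"
proof -
  \<comment> \<open>The points at distance at least \<open>d - \<rho>\<close> from the spectrum. One
    bound on this closed set serves all \<open>z\<close>, which makes the constant uniform.\<close>
  define D where "D = {z. \<forall>v. cmod (v - z) < d - \<rho> \<longrightarrow> (\<exists>b. is_inverse (e v - a) b)}"
  have "D = - (\<Union>v\<in>{v. \<nexists>b. is_inverse (e v - a) b}. ball v (d - \<rho>))"
    by (auto simp: D_def dist_norm)
  then have closed: "closed D" by auto
  have Dinv: "\<exists>b. is_inverse (e w - a) b" if "w \<in> D" for w
    using that \<rho> by (auto simp: D_def)
  obtain M where M: "M \<ge> 0" "\<And>w b. w \<in> D \<Longrightarrow> is_inverse (e w - a) b \<Longrightarrow> norm b \<le> M"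
    using resolvent_bounded_on_closed[OF closed Dinv] by blast
  obtain R where R: "\<And>w. w \<in> D \<Longrightarrow> is_inverse (e w - a) (R w)"
    using Dinv by metis
  let ?M = "norm (1::'a) + K * \<rho> * M"
  have M0: "0 \<le> ?M" using M \<rho> by simp
  show ?thesis
  proof (rule that[of "K * ?M"])
    fix z b m
    assume z: "\<forall>v. cmod (v - z) < d \<longrightarrow> (\<exists>b. is_inverse (e v - a) b)"
      and b: "is_inverse (e z - a) b"
    have D: "z - w \<in> D" if "cmod w \<le> \<rho>" for w
      unfolding D_def
    proof (intro CollectI allI impI)
      fix v assume v: "cmod (v - (z - w)) < d - \<rho>"
      have "cmod (v - z) \<le> cmod (v - (z - w)) + cmod w"
        using norm_triangle_ineq4[of "v - (z - w)" w] by simp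
      then show "\<exists>b. is_inverse (e v - a) b" using z v that by auto
    qed
    have "J * b = b * J"
      by (rule is_inverse_commute[OF b, symmetric]) (simp add: algebra_simps Ja J_commute_e)
    then show "norm (b ^ m) \<le> K * ?M / \<rho> ^ m"
    proof (rule norm_power_le_of_inverse_bound[OF _ \<rho>(1) M0, where f = "\<lambda>w. (e z - a) * R (z - w)"])
      fix w assume w: "cmod w \<le> \<rho>"
      have "1 - e w * b = (e (z - w) - a) * b"
      proof -
        have "(e (z - w) - a) * b = (e z - a) * b - e w * b"
          by (simp add: e_diff algebra_simps)
        then show ?thesis using b by (simp add: is_inverse_def)
      qed
      moreover have "is_inverse b (e z - a)"
        using b by (simp add: is_inverse_def)
      ultimately show "is_inverse (1 - e w * b) ((e z - a) * R (z - w))"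
        using is_inverse_mult[OF R[OF D[OF w]]] by simp
      \<comment> \<open>This removes the factor \<open>e z - a\<close>, which is not bounded in
        \<open>z\<close>.\<close>
      have "(e z - a) * R (z - w) = (e (z - w) - a) * R (z - w) + e w * R (z - w)"
        by (simp add: e_diff algebra_simps)
      also have "\<dots> = 1 + e w * R (z - w)"
        using R[OF D[OF w]] by (simp add: is_inverse_def)
      also have "norm \<dots> \<le> norm (1::'a) + norm (e w * R (z - w))"
        by (rule norm_triangle_ineq)
      also have "norm (e w * R (z - w)) \<le> K * cmod w * norm (R (z - w))"
        by (rule norm_e_mult_le)
      also have "\<dots> \<le> K * \<rho> * M"
        using w \<rho> M(2)[OF D[OF w] R[OF D[OF w]]] by (intro mult_mono) auto
      finally show "norm ((e z - a) * R (z - w)) \<le> ?M" by simp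
    qed
  qed (use M0 in simp)
qed

text \<open>The two power bounds dominate the series by a geometric one, uniformly on
  \<open>D\<close>; telescoping identifies its sum as the inverse.\<close>

lemma resolvent_of_commuting_perturbation:
  assumes Ja: "J * a = a * J" and Jn: "J * n = n * J" and an: "a * n = n * a"
    and \<epsilon>: "0 < \<epsilon>" "\<epsilon> < d"
    and n: "\<And>w. cmod w \<ge> \<epsilon> \<Longrightarrow> \<exists>b. is_inverse (e w - n) b"
    and D: "\<And>z v. z \<in> D \<Longrightarrow> cmod (v - z) < d \<Longrightarrow> \<exists>b. is_inverse (e v - a) b"
    and R: "\<And>z. z \<in> D \<Longrightarrow> is_inverse (e z - a) (R z)"
  obtains G where "\<forall>z\<in>D. is_inverse (e z - (a + n)) (G z)"
    "uniform_limit D (\<lambda>M z. \<Sum>m<M. n ^ m * R z ^ Suc m) G sequentially"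
proof -
  \<comment> \<open>\<open>\<rho> > \<epsilon>\<close> makes the ratio
    \<open>\<epsilon> / \<rho>\<close> less than 1, and \<open>\<rho> < d\<close> is what the
    resolvent bound asks for.\<close>
  define \<rho> where "\<rho> = (\<epsilon> + d) / 2"
  have \<rho>: "\<epsilon> < \<rho>" "0 < \<rho>" "\<rho> < d" using \<epsilon> by (auto simp: \<rho>_def)
  obtain C1 where C1: "C1 \<ge> 0" "\<And>m. norm (n ^ m) \<le> C1 * \<epsilon> ^ m"
    using norm_power_le_of_spectrum_in_ball[OF Jn \<epsilon>(1) n] by blast
  obtain C2 where C2: "C2 \<ge> 0"
    "\<And>z b m. (\<forall>v. cmod (v - z) < d \<longrightarrow> (\<exists>b. is_inverse (e v - a) b)) \<Longrightarrow>
      is_inverse (e z - a) b \<Longrightarrow> norm (b ^ m) \<le> C2 / \<rho> ^ m"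
    using norm_resolvent_power_le[OF Ja \<rho>(2,3)] by blast
  have C2R: "norm (R z ^ m) \<le> C2 / \<rho> ^ m" if "z \<in> D" for z m
    using C2(2) D[OF that] R[OF that] by blast
  have le: "norm (n ^ m * R z ^ l) \<le> C1 * \<epsilon> ^ m * (C2 / \<rho> ^ l)" if "z \<in> D" for z m l
  proof (rule order_trans[OF norm_mult_ineq mult_mono])
    show "norm (n ^ m) \<le> C1 * \<epsilon> ^ m" by (rule C1(2))
    show "norm (R z ^ l) \<le> C2 / \<rho> ^ l" by (rule C2R[OF that])
  qed (use C1(1) \<epsilon> in auto)
  \<comment> \<open>\<open>l = Suc m\<close> gives the majorant of the series, \<open>l = m\<close>
    the bound for the telescoping remainder.\<close>
  have geo: "C1 * \<epsilon> ^ m * (C2 / \<rho> ^ l) = C1 * C2 / \<rho> ^ (l - m) * (\<epsilon> / \<rho>) ^ m" if "m \<le> l" for m l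
  proof -
    have "\<rho> ^ l = \<rho> ^ (l - m) * \<rho> ^ m" using that by (simp add: power_add[symmetric])
    then show ?thesis by (simp add: power_divide)
  qed
  have small: "\<bar>\<epsilon> / \<rho>\<bar> < 1" using \<rho> \<epsilon> by simp
  have "summable (\<lambda>m. C1 * \<epsilon> ^ m * (C2 / \<rho> ^ Suc m))"
    unfolding geo[OF le_SucI[OF order_refl]] using small
    by (simp add: Suc_diff_le summable_mult summable_geometric)
  then have unif: "uniform_limit D (\<lambda>M z. \<Sum>m<M. n ^ m * R z ^ Suc m)
      (\<lambda>z. \<Sum>m. n ^ m * R z ^ Suc m) sequentially"
    by (rule Weierstrass_m_test[rotated]) (use le in blast)
  have "is_inverse (e z - (a + n)) (\<Sum>m. n ^ m * R z ^ Suc m)" if z: "z \<in> D" for z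
  proof -
    let ?c = "e z - a" and ?b = "R z" and ?S = "\<lambda>M. \<Sum>m<M. n ^ m * R z ^ Suc m"
    have cb: "?c * ?b = 1" "?b * ?c = 1" using R[OF z] by (auto simp: is_inverse_def)
    have cn: "?c * n = n * ?c" by (simp add: algebra_simps an e_commute[OF Jn])
    have bn: "?b * n = n * ?b" by (rule is_inverse_commute[OF R[OF z] cn])
    have lim: "?S \<longlonglongrightarrow> (\<Sum>m. n ^ m * ?b ^ Suc m)"
      using tendsto_uniform_limitI[OF unif z] .
    have lim1: "(\<lambda>M. 1 - n ^ M * ?b ^ M) \<longlonglongrightarrow> 1"
    proof -
      have "(\<lambda>M. C1 * C2 * (\<epsilon> / \<rho>) ^ M) \<longlonglongrightarrow> 0"
        using tendsto_mult_right_zero[OF LIMSEQ_power_zero[of "\<epsilon> / \<rho>"]] small by simp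
      moreover have "norm (n ^ M * ?b ^ M) \<le> C1 * C2 * (\<epsilon> / \<rho>) ^ M" for M
        using le[OF z, of M M] geo[of M M] by simp
      ultimately have "(\<lambda>M. n ^ M * ?b ^ M) \<longlonglongrightarrow> 0"
        by (rule Lim_null_comparison[OF always_eventually, OF allI, rotated])
      from tendsto_diff[OF tendsto_const[of 1] this] show ?thesis by simp
    qed
    \<comment> \<open>Consecutive terms cancel up to the remainder \<open>n ^ M * ?b ^ M\<close>.
      Both orders of the product are tracked, as the inverse has to be two-sided.\<close>
    have tele: "?S M * (?c - n) = 1 - n ^ M * ?b ^ M \<and> (?c - n) * ?S M = 1 - n ^ M * ?b ^ M" for M
    proof (induction M)
      case (Suc M)
      have comm: "?b ^ M * n = n * ?b ^ M" "?b * n ^ M = n ^ M * ?b" "?c * n ^ M = n ^ M * ?c"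
        "?b ^ Suc M * n = n * ?b ^ Suc M"
        using power_commuting_commutes[OF bn, of M] power_commuting_commutes[OF bn, of "Suc M"]
          power_commuting_commutes[OF bn[symmetric], of M] power_commuting_commutes[OF cn[symmetric], of M]
        by (simp_all del: power_Suc)
      have "n ^ M * ?b ^ Suc M * (?c - n) = n ^ M * (?b ^ Suc M * ?c) - n ^ M * (?b ^ Suc M * n)"
        by (simp only: right_diff_distrib mult.assoc)
      also have "?b ^ Suc M * ?c = ?b ^ M"
        by (simp only: power_Suc2 mult.assoc cb mult_1_right)
      also have "n ^ M * (?b ^ Suc M * n) = n ^ Suc M * ?b ^ Suc M"
        unfolding comm by (simp only: power_Suc2 mult.assoc)
      finally have 1: "n ^ M * ?b ^ Suc M * (?c - n) = n ^ M * ?b ^ M - n ^ Suc M * ?b ^ Suc M" .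
      have "(?c - n) * (n ^ M * ?b ^ Suc M) = (?c * n ^ M) * ?b ^ Suc M - n ^ Suc M * ?b ^ Suc M"
        by (simp only: left_diff_distrib mult.assoc power_Suc)
      also have "(?c * n ^ M) * ?b ^ Suc M = n ^ M * ((?c * ?b) * ?b ^ M)"
        unfolding comm by (simp only: power_Suc mult.assoc)
      finally have 2: "(?c - n) * (n ^ M * ?b ^ Suc M) = n ^ M * ?b ^ M - n ^ Suc M * ?b ^ Suc M"
        by (simp only: cb mult_1_left)
      show ?case
        unfolding sum.lessThan_Suc distrib_left distrib_right 1 2
        using Suc by (simp only: diff_add_cancel add_diff_eq)
    qed simp
    have "(\<Sum>m. n ^ m * ?b ^ Suc m) * (?c - n) = 1" "(?c - n) * (\<Sum>m. n ^ m * ?b ^ Suc m) = 1"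
      using LIMSEQ_unique[OF tendsto_mult[OF lim tendsto_const[of "?c - n"], unfolded conjunct1[OF tele]] lim1]
        LIMSEQ_unique[OF tendsto_mult[OF tendsto_const[of "?c - n"] lim, unfolded conjunct2[OF tele]] lim1]
      by blast+
    then show ?thesis by (simp add: is_inverse_def diff_diff_eq)
  qed
  then have "\<forall>z\<in>D. is_inverse (e z - (a + n)) (\<Sum>m. n ^ m * R z ^ Suc m)"
    by blast
  then show ?thesis using unif by (rule that)
qed

end


section \<open>Operators on the complexification\<close>

text \<open>A copy of the bounded operators in which composition is the ring product, so that the
  Banach algebra results apply.\<close>

typedef (overloaded) 'a endo = "UNIV :: ('a::real_normed_vector \<Rightarrow>\<^sub>L 'a) set"
  morphisms endo_blinfun Endo
  by simp

setup_lifting type_definition_endo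

instantiation endo :: (real_normed_vector) "{zero, one, plus, minus, uminus, scaleR, times, norm, dist}"
begin

lift_definition zero_endo :: "'a endo" is 0 .
lift_definition one_endo :: "'a endo" is id_blinfun .
lift_definition plus_endo :: "'a endo \<Rightarrow> 'a endo \<Rightarrow> 'a endo" is "(+)" .
lift_definition minus_endo :: "'a endo \<Rightarrow> 'a endo \<Rightarrow> 'a endo" is "(-)" .
lift_definition uminus_endo :: "'a endo \<Rightarrow> 'a endo" is uminus .
lift_definition scaleR_endo :: "real \<Rightarrow> 'a endo \<Rightarrow> 'a endo" is scaleR .
lift_definition times_endo :: "'a endo \<Rightarrow> 'a endo \<Rightarrow> 'a endo" is "(o\<^sub>L)" .
lift_definition norm_endo :: "'a endo \<Rightarrow> real" is norm .
lift_definition dist_endo :: "'a endo \<Rightarrow> 'a endo \<Rightarrow> real" is dist .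

instance ..

end

instantiation endo :: (real_normed_vector) "{real_normed_algebra, monoid_mult}"
begin

definition sgn_endo :: "'a endo \<Rightarrow> 'a endo" where
  "sgn_endo x = x /\<^sub>R norm x"

definition uniformity_endo :: "('a endo \<times> 'a endo) filter" where
  "uniformity_endo = (INF r\<in>{0 <..}. principal {(x, y). dist x y < r})"

definition open_endo :: "'a endo set \<Rightarrow> bool" where
  "open_endo U \<longleftrightarrow> (\<forall>x\<in>U. eventually (\<lambda>(x', y). x' = x \<longrightarrow> y \<in> U) uniformity)"

instance
proof
  fix x y z :: "'a endo" and r s :: real and U :: "'a endo set"
  show "x + y + z = x + (y + z)" "x + y = y + x" "0 + x = x" "- x + x = 0" "x - y = x + - y"
    "r *\<^sub>R (x + y) = r *\<^sub>R x + r *\<^sub>R y" "(r + s) *\<^sub>R x = r *\<^sub>R x + s *\<^sub>R x"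
    "r *\<^sub>R s *\<^sub>R x = (r * s) *\<^sub>R x" "1 *\<^sub>R x = x"
    by (transfer; simp add: algebra_simps)+
  show "dist x y = norm (x - y)" by transfer (rule dist_norm)
  show "sgn x = x /\<^sub>R norm x" by (rule sgn_endo_def)
  show "uniformity = (INF r\<in>{0 <..}. principal {(x, y :: 'a endo). dist x y < r})"
    by (rule uniformity_endo_def)
  show "open U \<longleftrightarrow> (\<forall>x\<in>U. eventually (\<lambda>(x', y). x' = x \<longrightarrow> y \<in> U) uniformity)"
    by (rule open_endo_def)
  show "norm x = 0 \<longleftrightarrow> x = 0" by transfer simp
  show "norm (x + y) \<le> norm x + norm y" by transfer (rule norm_triangle_ineq)
  show "norm (r *\<^sub>R x) = \<bar>r\<bar> * norm x" by transfer simp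
  show "norm (x * y) \<le> norm x * norm y" by transfer (rule norm_blinfun_compose)
  show "x * y * z = x * (y * z)" "1 * x = x" "x * 1 = x"
    "(x + y) * z = x * z + y * z" "x * (y + z) = x * y + x * z"
    "r *\<^sub>R x * y = r *\<^sub>R (x * y)" "x * r *\<^sub>R y = r *\<^sub>R (x * y)"
    by (transfer; auto intro!: blinfun_eqI simp: blinfun.bilinear_simps)+
qed

end

instance endo :: (banach) banach
proof
  fix X :: "nat \<Rightarrow> 'a endo"
  assume "Cauchy X"
  then have "Cauchy (\<lambda>n. endo_blinfun (X n))"
    by (simp add: Cauchy_def dist_endo.rep_eq)
  then obtain L where "(\<lambda>n. endo_blinfun (X n)) \<longlonglongrightarrow> L"
    using Cauchy_convergent convergent_def by blast
  then have "X \<longlonglongrightarrow> Endo L"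
    by (simp add: tendsto_iff dist_endo.rep_eq Endo_inverse)
  then show "convergent X" by (rule convergentI)
qed

lemma endo_eqI: "(\<And>x. endo_blinfun a x = endo_blinfun b x) \<Longrightarrow> a = b"
  by (metis blinfun_eqI endo_blinfun_inject)

lemmas endo_apply = zero_endo.rep_eq one_endo.rep_eq plus_endo.rep_eq minus_endo.rep_eq
  uminus_endo.rep_eq scaleR_endo.rep_eq times_endo.rep_eq

lemma op_power_0 [simp]: "op_power T 0 = id_blinfun"
  and op_power_Suc: "op_power T (Suc m) = T o\<^sub>L op_power T m"
  by (simp_all add: op_power_def)

section \<open>The complexification and its imaginary unit\<close>

lift_definition blinfun_diag ::
    "('a::real_normed_vector \<Rightarrow>\<^sub>L 'a) \<Rightarrow> ('a \<times> 'a) \<Rightarrow>\<^sub>L ('a \<times> 'a)" is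
  "\<lambda>T p. (T (fst p), T (snd p))"
  by (intro bounded_linear_Pair bounded_linear_compose[OF _ bounded_linear_fst]
      bounded_linear_compose[OF _ bounded_linear_snd])

text \<open>The pair \<open>(x, y)\<close> stands for \<open>x + i y\<close>, so this is
  multiplication by \<open>i\<close>.\<close>

lift_definition blinfun_J :: "('a::real_normed_vector \<times> 'a) \<Rightarrow>\<^sub>L ('a \<times> 'a)" is
  "\<lambda>p. (- snd p, fst p)"
  by (intro bounded_linear_Pair bounded_linear_minus bounded_linear_fst bounded_linear_snd)

definition complexify :: "('a::real_normed_vector \<Rightarrow>\<^sub>L 'a) \<Rightarrow> ('a \<times> 'a) endo" where
  "complexify T = Endo (blinfun_diag T)"

definition imag_unit :: "('a::real_normed_vector \<times> 'a) endo" where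
  "imag_unit = Endo blinfun_J"

lemma complexify_apply [simp]: "endo_blinfun (complexify T) p = (T (fst p), T (snd p))"
  by (simp add: complexify_def Endo_inverse blinfun_diag.rep_eq)

lemma imag_unit_apply [simp]: "endo_blinfun imag_unit p = (- snd p, fst p)"
  by (simp add: imag_unit_def Endo_inverse blinfun_J.rep_eq)

lemma complexify_compose: "complexify (S o\<^sub>L T) = complexify S * complexify T"
  and complexify_id: "complexify id_blinfun = 1"
  and complexify_add: "complexify (S + T) = complexify S + complexify T"
  and complexify_diff: "complexify (S - T) = complexify S - complexify T"
  and complexify_minus: "complexify (- T) = - complexify T"
  and complexify_scaleR: "complexify (r *\<^sub>R T) = r *\<^sub>R complexify T"
  and imag_unit_complexify: "imag_unit * complexify T = complexify T * imag_unit"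
  by (rule endo_eqI; simp add: endo_apply blinfun.bilinear_simps)+

lemma complexify_op_power: "complexify (op_power T m) = complexify T ^ m"
  by (induction m) (simp_all add: complexify_id complexify_compose op_power_Suc)

interpretation cplx: complex_structure "imag_unit :: ('a::banach \<times> 'a) endo"
  by standard (rule endo_eqI, simp add: endo_apply blinfun.bilinear_simps prod_eq_iff)


section \<open>Evaluation maps that replace the imaginary unit by an operator\<close>

lift_definition blinfun_graph :: "('a::real_normed_vector \<Rightarrow>\<^sub>L 'a) \<Rightarrow> 'a \<Rightarrow>\<^sub>L ('a \<times> 'a)" is
  "\<lambda>U x. (x, U x)"
  by (intro bounded_linear_Pair bounded_linear_ident)

text \<open>On \<open>A + i B\<close> this gives \<open>A + B U\<close>: it is the real part of
  \<open>(A + i B) (x - i U x)\<close>. Since \<open>U\<close> acts first, complexified factors on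
  the left can be pulled out.\<close>

definition left_eval ::
    "('a::real_normed_vector \<Rightarrow>\<^sub>L 'a) \<Rightarrow> ('a \<times> 'a) endo \<Rightarrow> 'a \<Rightarrow>\<^sub>L 'a" where
  "left_eval U Z = fst_blinfun o\<^sub>L endo_blinfun Z o\<^sub>L blinfun_graph (- U)"

text \<open>On \<open>A + i B\<close> this gives \<open>A + U B\<close>. Since \<open>U\<close> acts
  last, complexified factors on the right can be pulled out.\<close>

definition right_eval ::
    "('a::real_normed_vector \<Rightarrow>\<^sub>L 'a) \<Rightarrow> ('a \<times> 'a) endo \<Rightarrow> 'a \<Rightarrow>\<^sub>L 'a" where
  "right_eval U Z = (fst_blinfun + (U o\<^sub>L snd_blinfun)) o\<^sub>L endo_blinfun Z o\<^sub>L blinfun_graph 0"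

lemma left_eval_apply: "left_eval U Z x = fst (endo_blinfun Z (x, - U x))"
  by (simp add: left_eval_def blinfun_graph.rep_eq blinfun.bilinear_simps)

lemma right_eval_apply:
  "right_eval U Z x = fst (endo_blinfun Z (x, 0)) + U (snd (endo_blinfun Z (x, 0)))"
  by (simp add: right_eval_def blinfun_graph.rep_eq blinfun.bilinear_simps)

lemma left_eval_complexify_mult: "left_eval U (complexify A * Z) = A o\<^sub>L left_eval U Z"
  by (rule blinfun_eqI) (simp add: left_eval_apply endo_apply)

lemma right_eval_mult_complexify: "right_eval U (Z * complexify A) = right_eval U Z o\<^sub>L A"
  by (rule blinfun_eqI) (simp add: right_eval_apply endo_apply blinfun.bilinear_simps)

lemma eval_e:
  fixes U :: "'a::banach \<Rightarrow>\<^sub>L 'a"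
  shows "left_eval U (cplx.e c) = Re c *\<^sub>R id_blinfun + Im c *\<^sub>R U"
    and "right_eval U (cplx.e c) = Re c *\<^sub>R id_blinfun + Im c *\<^sub>R U"
  by (rule blinfun_eqI, simp add: left_eval_apply right_eval_apply cplx.e_def endo_apply
      blinfun.bilinear_simps)+

lemma bounded_linear_left_eval: "bounded_linear (left_eval U)"
  and norm_left_eval_le: "norm (left_eval U Z) \<le> (1 + norm U) * norm Z"
proof -
  show bnd: "norm (left_eval U Z) \<le> (1 + norm U) * norm Z" for Z
  proof (rule norm_blinfun_bound)
    fix x
    have "norm (left_eval U Z x) \<le> norm (endo_blinfun Z (x, - U x))"
      unfolding left_eval_apply by (metis norm_fst_le prod.collapse)
    also have "\<dots> \<le> norm Z * norm (x, - U x)"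
      unfolding norm_endo.rep_eq by (rule norm_blinfun)
    also have "\<dots> \<le> norm Z * (norm x + norm U * norm x)"
      using norm_Pair_le[of x "- U x"] norm_blinfun[of U x] by (intro mult_left_mono) auto
    finally show "norm (left_eval U Z x) \<le> (1 + norm U) * norm Z * norm x"
      by (simp add: algebra_simps)
  qed simp
  show "bounded_linear (left_eval U)"
  proof (rule bounded_linear_intro)
    show "norm (left_eval U Z) \<le> norm Z * (1 + norm U)" for Z
      using bnd[of Z] by (simp add: mult.commute)
  qed (rule blinfun_eqI; simp add: left_eval_apply endo_apply blinfun.bilinear_simps)+
qed

lemma bounded_linear_right_eval: "bounded_linear (right_eval U)"
  and norm_right_eval_le: "norm (right_eval U Z) \<le> (1 + norm U) * norm Z"
proof -
  show bnd: "norm (right_eval U Z) \<le> (1 + norm U) * norm Z" for Z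
  proof (rule norm_blinfun_bound)
    fix x
    let ?y = "endo_blinfun Z (x, 0)"
    have y: "norm ?y \<le> norm Z * norm x"
      unfolding norm_endo.rep_eq using norm_blinfun[of "endo_blinfun Z" "(x, 0)"] by simp
    have "norm (right_eval U Z x) \<le> norm (fst ?y) + norm U * norm (snd ?y)"
      unfolding right_eval_apply using norm_blinfun[of U "snd ?y"] by (intro norm_triangle_le) simp
    also have "\<dots> \<le> norm ?y + norm U * norm ?y"
      using norm_fst_le[of "fst ?y" "snd ?y"] norm_snd_le[of "snd ?y" "fst ?y"]
      by (intro add_mono mult_left_mono) simp_all
    also have "\<dots> = (1 + norm U) * norm ?y" by (simp add: algebra_simps)
    also have "\<dots> \<le> (1 + norm U) * (norm Z * norm x)"
      by (intro mult_left_mono y) simp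
    finally show "norm (right_eval U Z x) \<le> (1 + norm U) * norm Z * norm x"
      by (simp add: mult.assoc)
  qed simp
  show "bounded_linear (right_eval U)"
  proof (rule bounded_linear_intro)
    show "norm (right_eval U Z) \<le> norm Z * (1 + norm U)" for Z
      using bnd[of Z] by (simp add: mult.commute)
  qed (rule blinfun_eqI; simp add: right_eval_apply endo_apply blinfun.bilinear_simps algebra_simps)+
qed

section \<open>Invertibility and the factorisation of \<open>Q_op\<close>\<close>

lemma is_inverse_complexify:
  assumes "op_invertible T"
  shows "is_inverse (complexify T) (complexify (op_inverse T))"
  using op_inverse[OF assms] by (simp add: is_inverse_def complexify_compose[symmetric] complexify_id)

text \<open>The inverse of \<open>T\<close> is the real part of \<open>b\<close> restricted to real
  vectors, which is \<open>left_eval 0 b\<close>.\<close>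

lemma op_invertible_of_complexify:
  assumes "is_inverse (complexify T) b"
  shows "op_invertible T"
proof -
  define S where "S = left_eval 0 b"
  have Tb: "endo_blinfun (complexify T * b) p = p" and bT: "endo_blinfun (b * complexify T) p = p" for p
    using assms by (simp_all add: is_inverse_def one_endo.rep_eq)
  have "T (S x) = x" for x
    using Tb[of "(x, 0)"] by (simp add: S_def left_eval_apply endo_apply)
  moreover have "S (T x) = x" for x
    using bT[of "(x, 0)"] by (simp add: S_def left_eval_apply endo_apply blinfun.bilinear_simps)
  ultimately show ?thesis
    unfolding op_invertible_def by (intro exI[of _ S] conjI blinfun_eqI) simp_all
qed

lemma norm_paravector_polar:
  assumes "norm u = 1"
  shows "norm (Re z, Im z *\<^sub>R u) = cmod z"
  using assms by (simp add: norm_Pair cmod_def)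

text \<open>The coefficients of \<open>Q_op\<close> are the trace \<open>z + cnj z\<close> and the
  norm \<open>z * cnj z\<close>, so they depend only on \<open>z\<close> and not on the unit vector
  \<open>u\<close>.\<close>

lemma complexify_Q_op:
  fixes T :: "('v::banach, 'n::{finite,linorder}) cop" and u :: "(real, 'n) vec"
  assumes u: "norm u = 1"
  shows "complexify (Q_op (Re z, Im z *\<^sub>R u) T)
      = (cplx.e z - complexify T) * (cplx.e (cnj z) - complexify T)"
proof -
  have comm: "cplx.e z * complexify T = complexify T * cplx.e z"
    by (rule cplx.e_commute[OF imag_unit_complexify])
  have "cplx.e z * cplx.e (cnj z) = (cmod z)\<^sup>2 *\<^sub>R (1 :: (('v, 'n) cmodule \<times> _) endo)"
    unfolding cplx.e_mult[symmetric] complex_norm_square[symmetric] cplx.e_of_real ..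
  moreover have "cplx.e z + cplx.e (cnj z) = (2 * Re z) *\<^sub>R (1 :: (('v, 'n) cmodule \<times> _) endo)"
    unfolding cplx.e_add[symmetric] complex_add_cnj cplx.e_of_real by simp
  then have "complexify T * cplx.e (cnj z) + complexify T * cplx.e z = (2 * Re z) *\<^sub>R complexify T"
    by (simp add: distrib_left[symmetric] add.commute)
  ultimately show ?thesis
    by (simp add: Q_op_def norm_paravector_polar[OF u] complexify_add complexify_diff
        complexify_compose complexify_scaleR complexify_id left_diff_distrib right_diff_distrib comm)
      (simp add: algebra_simps)
qed

lemma Q_op_factors_commute:
  fixes T :: "'a::banach \<Rightarrow>\<^sub>L 'a"
  shows "(cplx.e z - complexify T) * (cplx.e w - complexify T)
    = (cplx.e w - complexify T) * (cplx.e z - complexify T)"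
proof -
  have "cplx.e z * complexify T = complexify T * cplx.e z" for z
    by (rule cplx.e_commute[OF imag_unit_complexify])
  moreover have "cplx.e z * cplx.e w = cplx.e w * (cplx.e z :: ('a \<times> 'a) endo)"
    by (simp add: cplx.e_mult[symmetric] mult.commute)
  ultimately show ?thesis by (simp add: left_diff_distrib right_diff_distrib)
qed

lemma is_inverse_of_Q_op:
  fixes T :: "('v::banach, 'n::{finite,linorder}) cop" and u :: "(real, 'n) vec"
  assumes u: "norm u = 1" and inv: "op_invertible (Q_op (Re z, Im z *\<^sub>R u) T)"
  shows "is_inverse (cplx.e z - complexify T)
    (complexify (op_inverse (Q_op (Re z, Im z *\<^sub>R u) T)) * (cplx.e (cnj z) - complexify T))"
  by (rule is_inverse_commuting_factor[OF _ Q_op_factors_commute])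
    (unfold complexify_Q_op[OF u, symmetric], rule is_inverse_complexify[OF inv])


section \<open>The S-resolvent operators\<close>

lemma scalar_op_add: "scalar_op (a + b) = scalar_op a + scalar_op b"
  for a b :: "'n::{finite,linorder} clifford"
  by (rule blinfun_eqI)
    (simp add: scalar_op_apply blinfun.bilinear_simps ctensor_def vec_eq_iff distrib_right
      plus_clifford.rep_eq scaleR_add_left sum.distrib)

lemma scalar_op_scaleR: "scalar_op (r *\<^sub>R a) = r *\<^sub>R scalar_op a"
  for a :: "'n::{finite,linorder} clifford"
  by (rule blinfun_eqI)
    (simp add: scalar_op_apply blinfun.bilinear_simps ctensor_def vec_eq_iff
      scaleR_clifford.rep_eq scaleR_sum_right)

lemma scalar_op_sum: "scalar_op (\<Sum>i\<in>I. f i) = (\<Sum>i\<in>I. scalar_op (f i))"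
  for f :: "'i \<Rightarrow> 'n::{finite,linorder} clifford"
proof (induction I rule: infinite_finite_induct)
  have "scalar_op (0 :: 'n clifford) = 0"
    using scalar_op_scaleR[of 0 "0 :: 'n clifford"] by simp
  then show "scalar_op (\<Sum>i\<in>{}. f i) = (\<Sum>i\<in>{}. scalar_op (f i))"
    "infinite A \<Longrightarrow> scalar_op (\<Sum>i\<in>A. f i) = (\<Sum>i\<in>A. scalar_op (f i))" for A
    by simp_all
qed (simp add: scalar_op_add)

text \<open>Adding the double sum to its transpose lets the anticommutation relations cancel all
  off-diagonal terms.\<close>

lemma imaginary_paravector_squared:
  fixes u :: "(real, 'n::{finite,linorder}) vec"
  shows "paravector (0, u) * paravector (0, u) = - ((norm u)\<^sup>2 *\<^sub>R 1)"
proof -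
  let ?p = "paravector (0, u) :: 'n clifford"
  have sq: "?p * ?p = (\<Sum>i\<in>UNIV. \<Sum>j\<in>UNIV. (u $ i * u $ j) *\<^sub>R (e_gen i * e_gen j))"
    by (simp add: paravector_def sum_product) (intro sum.cong refl, simp add: mult.commute)
  also have "\<dots> = (\<Sum>j\<in>UNIV. \<Sum>i\<in>UNIV. (u $ i * u $ j) *\<^sub>R (e_gen i * e_gen j))"
    by (rule sum.swap)
  also have "\<dots> = (\<Sum>i\<in>UNIV. \<Sum>j\<in>UNIV. (u $ i * u $ j) *\<^sub>R (e_gen j * e_gen i))"
    by (intro sum.cong refl) (simp add: mult.commute)
  finally have "2 *\<^sub>R (?p * ?p) = (\<Sum>i\<in>UNIV. \<Sum>j\<in>UNIV. (u $ i * u $ j) *\<^sub>R (e_gen i * e_gen j))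
      + (\<Sum>i\<in>UNIV. \<Sum>j\<in>UNIV. (u $ i * u $ j) *\<^sub>R (e_gen j * e_gen i))"
    unfolding scaleR_2 using sq by simp
  also have "\<dots> = (\<Sum>i\<in>UNIV. \<Sum>j\<in>UNIV. if i = j then (u $ i * u $ j) *\<^sub>R (- 2) else 0)"
    unfolding sum.distrib[symmetric] scaleR_add_right[symmetric] e_gen_anticommute
    by (intro sum.cong) auto
  also have "\<dots> = (\<Sum>i\<in>UNIV. (u $ i)\<^sup>2 *\<^sub>R (- 2))"
    by (simp add: power2_eq_square)
  also have "\<dots> = (norm u)\<^sup>2 *\<^sub>R (- 2)"
    unfolding scaleR_sum_left[symmetric] by (simp add: norm_vec_def L2_set_def sum_nonneg)
  also have "\<dots> = 2 *\<^sub>R (- ((norm u)\<^sup>2 *\<^sub>R 1))"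
    by (simp add: scaleR_conv_of_real mult_2 mult_2_right)
  finally show ?thesis by (rule scaleR_left_imp_eq[rotated]) simp
qed

lemma power_in_complex_plane:
  fixes q :: "'a::real_algebra_1"
  assumes q: "q * q = - 1"
  shows "(Re c *\<^sub>R 1 + Im c *\<^sub>R q) ^ m = Re (c ^ m) *\<^sub>R 1 + Im (c ^ m) *\<^sub>R q"
  by (induction m) (simp_all add: algebra_simps q)

lemma scalar_op_paravector_power:
  fixes u :: "(real, 'n::{finite,linorder}) vec"
  assumes u: "norm u = 1"
  shows "scalar_op (paravector (cnj_paravector (Re z, Im z *\<^sub>R u)) ^ m)
    = Re (cnj z ^ m) *\<^sub>R id_blinfun + Im (cnj z ^ m) *\<^sub>R scalar_op (paravector (0, u))"
proof -
  have "paravector (cnj_paravector (Re z, Im z *\<^sub>R u)) = Re (cnj z) *\<^sub>R 1 + Im (cnj z) *\<^sub>R paravector (0, u)"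
    by (simp add: paravector_def cnj_paravector_def of_real_def scaleR_sum_right sum_negf)
  moreover have "paravector (0, u) * paravector (0, u) = - (1 :: 'n clifford)"
    by (simp add: imaginary_paravector_squared u)
  ultimately show ?thesis
    by (simp only: power_in_complex_plane scalar_op_add scalar_op_scaleR scalar_op_one)
qed

text \<open>The unit vector varies with \<open>s\<close>; a common bound for these operators keeps
  convergence uniform. The coordinates of a unit vector are at most 1 in absolute value.\<close>

lemma norm_scalar_op_imaginary_le:
  obtains B where "\<And>u :: (real, 'n::{finite,linorder}) vec. norm u = 1 \<Longrightarrow>
    norm (scalar_op (paravector (0, u)) :: ('v::real_normed_vector, 'n) cop) \<le> B"
proof
  fix u :: "(real, 'n) vec" assume u: "norm u = 1"
  have "scalar_op (paravector (0, u)) = (\<Sum>j\<in>UNIV. u $ j *\<^sub>R (scalar_op (e_gen j) :: ('v, 'n) cop))"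
    by (simp add: paravector_def scalar_op_sum scalar_op_scaleR)
  also have "norm \<dots> \<le> (\<Sum>j\<in>UNIV. norm (scalar_op (e_gen j) :: ('v, 'n) cop))"
  proof (rule sum_norm_le)
    fix j
    have "\<bar>u $ j\<bar> \<le> 1" using component_le_norm_cart[of u j] u by simp
    then show "norm (u $ j *\<^sub>R (scalar_op (e_gen j) :: ('v, 'n) cop))
        \<le> norm (scalar_op (e_gen j) :: ('v, 'n) cop)"
      by (simp add: mult_left_le_one_le)
  qed
  finally show "norm (scalar_op (paravector (0, u)) :: ('v, 'n) cop)
      \<le> (\<Sum>j\<in>UNIV. norm (scalar_op (e_gen j) :: ('v, 'n) cop))" .
qed

text \<open>Commutation splits \<open>r ^ m\<close> into the power of the inverse of
  \<open>Q_op\<close> and \<open>(cnj z - T) ^ m\<close>, in either order. Each evaluation map lets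
  the operator factors out on its own side and turns the remaining powers of \<open>cnj z\<close>
  into powers of the conjugate paravector, which yields the star powers.\<close>

lemma SL_SR_eq_eval:
  fixes T :: "('v::banach, 'n::{finite,linorder}) cop" and u :: "(real, 'n) vec"
  assumes u: "norm u = 1" and inv: "op_invertible (Q_op (Re z, Im z *\<^sub>R u) T)"
    and r: "is_inverse (cplx.e z - complexify T) r"
  shows "SL m (Re z, Im z *\<^sub>R u) T = left_eval (scalar_op (paravector (0, u))) (r ^ m)"
    and "SR m (Re z, Im z *\<^sub>R u) T = right_eval (scalar_op (paravector (0, u))) (r ^ m)"
proof -
  let ?s = "(Re z, Im z *\<^sub>R u)" and ?U = "scalar_op (paravector (0, u)) :: ('v, 'n) cop"
  let ?\<tau> = "complexify T" and ?B = "op_inverse (Q_op (Re z, Im z *\<^sub>R u) T)"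
  interpret L: bounded_linear "left_eval ?U" by (rule bounded_linear_left_eval)
  interpret R: bounded_linear "right_eval ?U" by (rule bounded_linear_right_eval)
  have e\<tau>: "cplx.e w * ?\<tau> = ?\<tau> * cplx.e w" for w
    by (rule cplx.e_commute[OF imag_unit_complexify])
  have r_eq: "r = complexify ?B * (cplx.e (cnj z) - ?\<tau>)"
    by (rule is_inverse_unique[OF r is_inverse_of_Q_op[OF u inv]])
  have "complexify (Q_op ?s T) * (cplx.e (cnj z) - ?\<tau>) = (cplx.e (cnj z) - ?\<tau>) * complexify (Q_op ?s T)"
    unfolding complexify_Q_op[OF u] by (simp only: mult.assoc[symmetric] Q_op_factors_commute[of "cnj z" T z])
  then have comm: "complexify ?B * (cplx.e (cnj z) - ?\<tau>) = (cplx.e (cnj z) - ?\<tau>) * complexify ?B"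
    by (rule is_inverse_commute[OF is_inverse_complexify[OF inv]])
  have rL: "r ^ m = complexify (op_power ?B m) * (cplx.e (cnj z) - ?\<tau>) ^ m"
    unfolding r_eq complexify_op_power by (rule power_mult_distrib_commuting[OF comm])
  have rR: "r ^ m = (cplx.e (cnj z) - ?\<tau>) ^ m * complexify (op_power ?B m)"
    unfolding r_eq comm complexify_op_power by (rule power_mult_distrib_commuting[OF comm[symmetric]])
  have c1: "(- ?\<tau>) * cplx.e (cnj z) = cplx.e (cnj z) * (- ?\<tau>)"
    by (simp add: e\<tau>)
  have binom: "(cplx.e (cnj z) - ?\<tau>) ^ m
      = (\<Sum>k\<le>m. real (m choose k) *\<^sub>R (complexify (op_power (- T) k) * cplx.e (cnj z ^ (m - k))))"
    using binomial_commuting[OF c1, of m] by (simp add: complexify_op_power complexify_minus cplx.e_power)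
  have swap: "complexify (op_power (- T) k) * cplx.e w = cplx.e w * complexify (op_power (- T) k)" for k w
    by (rule cplx.e_commute[OF imag_unit_complexify, symmetric])
  have "left_eval ?U ((cplx.e (cnj z) - ?\<tau>) ^ m) = star_left_power ?s T m"
    unfolding binom star_left_power_def scalar_op_paravector_power[OF u]
    by (simp only: L.sum L.scaleR left_eval_complexify_mult eval_e)
  then show "SL m ?s T = left_eval ?U (r ^ m)"
    unfolding SL_def rL left_eval_complexify_mult by simp
  have "right_eval ?U ((cplx.e (cnj z) - ?\<tau>) ^ m) = star_right_power ?s T m"
    unfolding binom swap star_right_power_def scalar_op_paravector_power[OF u]
    by (simp only: R.sum R.scaleR right_eval_mult_complexify eval_e)
  then show "SR m ?s T = right_eval ?U (r ^ m)"
    unfolding SR_def rR right_eval_mult_complexify by simp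
qed

section \<open>Uniform convergence of the S-resolvent series\<close>

text \<open>The evaluation map changes with \<open>s\<close>, so one bound \<open>B\<close> for the
  whole family is what preserves uniformity.\<close>

lemma uniform_limit_bounded_additive:
  fixes \<phi> :: "'b \<Rightarrow> 'a::real_normed_vector \<Rightarrow> 'c::real_normed_vector"
  assumes lim: "uniform_limit D S G sequentially"
    and z: "\<And>s. s \<in> C \<Longrightarrow> z s \<in> D"
    and B: "\<And>s x. s \<in> C \<Longrightarrow> norm (\<phi> s x) \<le> B * norm x"
    and diff: "\<And>s x y. s \<in> C \<Longrightarrow> \<phi> s (x - y) = \<phi> s x - \<phi> s y"
  shows "uniform_limit C (\<lambda>M s. \<phi> s (S M (z s))) (\<lambda>s. \<phi> s (G (z s))) sequentially"
proof (rule uniform_limitI)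
  fix r :: real assume r: "r > 0"
  then have "\<forall>\<^sub>F M in sequentially. \<forall>x\<in>D. dist (S M x) (G x) < r / (\<bar>B\<bar> + 1)"
    by (intro uniform_limitD[OF lim]) simp
  then show "\<forall>\<^sub>F M in sequentially. \<forall>s\<in>C. dist (\<phi> s (S M (z s))) (\<phi> s (G (z s))) < r"
  proof eventually_elim
    case (elim M)
    show ?case
    proof
      fix s assume s: "s \<in> C"
      let ?x = "S M (z s) - G (z s)"
      have "norm (\<phi> s ?x) \<le> B * norm ?x" by (rule B[OF s])
      also have "\<dots> \<le> (\<bar>B\<bar> + 1) * norm ?x" by (intro mult_right_mono) auto
      also have "\<dots> < r"
        using elim z[OF s] by (auto simp: dist_norm field_simps)
      finally show "dist (\<phi> s (S M (z s))) (\<phi> s (G (z s))) < r"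
        by (simp add: dist_norm diff[OF s])
    qed
  qed
qed

lemma S_resolvent_series_uniform:
  fixes T N :: "('v::banach, 'n::{finite,linorder}) cop"
  assumes TN: "T o\<^sub>L N = N o\<^sub>L T" and \<epsilon>: "\<epsilon> > 0"
    and N: "S_spectrum N \<subseteq> ball 0 \<epsilon>"
    and C: "dist_set_set C (S_spectrum T) > ereal \<epsilon>"
  shows "C \<subseteq> S_resolvent_set (T + N)"
    and "uniform_limit C (\<lambda>M s. \<Sum>m<M. op_power N m o\<^sub>L SL (m + 1) s T)
      (\<lambda>s. SL 1 s (T + N)) sequentially"
    and "uniform_limit C (\<lambda>M s. \<Sum>m<M. SR (m + 1) s T o\<^sub>L op_power N m)
      (\<lambda>s. SR 1 s (T + N)) sequentially"
proof -
  let ?\<tau> = "complexify T" and ?\<nu> = "complexify N"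
  let ?U = "\<lambda>u. scalar_op (paravector (0, u)) :: ('v, 'n) cop"
  \<comment> \<open>The distance may be infinite; a real radius with room beyond
    \<open>\<epsilon>\<close> is inserted.\<close>
  obtain d where d: "\<epsilon> < d" "ereal d < dist_set_set C (S_spectrum T)"
    using ereal_dense2[OF C] by auto
  have far: "d < dist s p" if "s \<in> C" "p \<in> S_spectrum T" for s p
    using less_INF_D[OF less_INF_D[OF d(2)[unfolded dist_set_set_def] that(1), unfolded dist_point_set_def] that(2)]
    by simp
  define z :: "'n paravector \<Rightarrow> complex" where "z s = Complex (fst s) (norm (snd s))" for s
  \<comment> \<open>A real point \<open>s\<close> is represented with any unit vector, so a
    coordinate vector is chosen.\<close>
  define u :: "'n paravector \<Rightarrow> (real, 'n) vec"
    where "u s = (if snd s = 0 then axis undefined 1 else snd s /\<^sub>R norm (snd s))" for s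
  have u: "norm (u s) = 1" for s by (simp add: u_def)
  have polar: "s = (Re (z s), Im (z s) *\<^sub>R u s)" for s
    by (cases s) (simp add: z_def u_def)
  \<comment> \<open>The conjugates are included because \<open>Q_op s (T + N)\<close> has a factor
    for \<open>z s\<close> and one for \<open>cnj (z s)\<close>, and both must be
    invertible.\<close>
  define D where "D = z ` C \<union> cnj ` z ` C"
  \<comment> \<open>For a fixed unit vector \<open>w\<close> the map from \<open>v\<close> to the
    paravector is an isometry, so a complex disc of radius \<open>d\<close> around \<open>y\<close>
    avoids the S-spectrum.\<close>
  have D_inv: "op_invertible (Q_op (Re v, Im v *\<^sub>R w) T)"
    if "norm w = 1" "(Re y, Im y *\<^sub>R w) \<in> C" "cmod (v - y) < d" for v y and w :: "(real, 'n) vec"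
  proof -
    have "(Re y, Im y *\<^sub>R w) - (Re v, Im v *\<^sub>R w) = - (Re (v - y), Im (v - y) *\<^sub>R w)"
      by (simp add: scaleR_diff_left)
    then have "dist (Re y, Im y *\<^sub>R w) (Re v, Im v *\<^sub>R w) = norm (Re (v - y), Im (v - y) *\<^sub>R w)"
      by (simp only: dist_norm norm_minus_cancel)
    also have "\<dots> < d" unfolding norm_paravector_polar[OF that(1)] by (rule that(3))
    finally show ?thesis using far[OF that(2), of "(Re v, Im v *\<^sub>R w)"] by (auto simp: S_spectrum_def)
  qed
  have D_polar: "\<exists>w. norm w = 1 \<and> (Re y, Im y *\<^sub>R w) \<in> C" if "y \<in> D" for y
  proof -
    from that obtain s where s: "s \<in> C" "y = z s \<or> y = cnj (z s)" by (auto simp: D_def)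
    \<comment> \<open>Conjugating \<open>z s\<close> is undone by replacing \<open>u s\<close> with
      its negative.\<close>
    have "(Re y, Im y *\<^sub>R (if y = z s then u s else - u s)) = s"
      using s(2) polar[of s, symmetric] by auto
    then show ?thesis
      using s(1) u[of s] by (intro exI[of _ "if y = z s then u s else - u s"]) simp
  qed
  have T_inv: "\<exists>b. is_inverse (cplx.e v - ?\<tau>) b" if "y \<in> D" "cmod (v - y) < d" for y v
    using D_polar[OF that(1)] D_inv[OF _ _ that(2)] is_inverse_of_Q_op by blast
  have N_inv: "\<exists>b. is_inverse (cplx.e v - ?\<nu>) b" if "cmod v \<ge> \<epsilon>" for v
  proof -
    have "norm (Re v, Im v *\<^sub>R u 0) \<ge> \<epsilon>"
      using that norm_paravector_polar[OF u] by simp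
    then have "(Re v, Im v *\<^sub>R u 0) \<notin> S_spectrum N" using N by auto
    then show ?thesis using is_inverse_of_Q_op[OF u[of 0]] by (auto simp: S_spectrum_def)
  qed
  have d0: "0 < d" using d \<epsilon> by simp
  then have "\<exists>b. is_inverse (cplx.e y - ?\<tau>) b" if "y \<in> D" for y
    using T_inv[OF that, of y] by simp
  then obtain R where R: "\<And>y. y \<in> D \<Longrightarrow> is_inverse (cplx.e y - ?\<tau>) (R y)"
    by metis
  have comm: "?\<tau> * ?\<nu> = ?\<nu> * ?\<tau>"
    by (simp add: complexify_compose[symmetric] TN)
  obtain G where "\<forall>y\<in>D. is_inverse (cplx.e y - (?\<tau> + ?\<nu>)) (G y)"
    and lim: "uniform_limit D (\<lambda>M y. \<Sum>m<M. ?\<nu> ^ m * R y ^ Suc m) G sequentially"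
    by (rule cplx.resolvent_of_commuting_perturbation[OF imag_unit_complexify imag_unit_complexify comm
      \<epsilon> d(1) N_inv T_inv R])
  then have G: "is_inverse (cplx.e y - (?\<tau> + ?\<nu>)) (G y)" if "y \<in> D" for y
    using that by blast
  have zD: "z s \<in> D" "cnj (z s) \<in> D" if "s \<in> C" for s
    using that by (auto simp: D_def)
  have Q_T: "op_invertible (Q_op (Re (z s), Im (z s) *\<^sub>R u s) T)" if "s \<in> C" for s
    by (rule D_inv[OF u, of "z s"]) (use that d0 polar[of s, symmetric] in auto)
  have Q_TN: "op_invertible (Q_op (Re (z s), Im (z s) *\<^sub>R u s) (T + N))" if "s \<in> C" for s
    using is_inverse_mult[OF G G, OF zD[OF that]]
    by (intro op_invertible_of_complexify) (simp add: complexify_Q_op[OF u] complexify_add)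
  show "C \<subseteq> S_resolvent_set (T + N)"
    using Q_TN polar[symmetric] by (auto simp: S_resolvent_set_def S_spectrum_def)
  obtain B where B: "\<And>w. norm w = 1 \<Longrightarrow> norm (?U w) \<le> B"
    using norm_scalar_op_imaginary_le by blast
  have eval_bound: "(1 + norm (?U (u s))) * norm x \<le> (1 + B) * norm x"
    for s and x :: "(('v, 'n) cmodule \<times> ('v, 'n) cmodule) endo"
    using B[OF u[of s]] by (intro mult_right_mono) auto
  have R_s: "is_inverse (cplx.e (z s) - ?\<tau>) (R (z s))" if "s \<in> C" for s
    by (rule R[OF zD(1)[OF that]])
  have G_s: "is_inverse (cplx.e (z s) - complexify (T + N)) (G (z s))" if "s \<in> C" for s
    unfolding complexify_add by (rule G[OF zD(1)[OF that]])
  show "uniform_limit C (\<lambda>M s. \<Sum>m<M. op_power N m o\<^sub>L SL (m + 1) s T)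
      (\<lambda>s. SL 1 s (T + N)) sequentially"
  proof (rule uniform_limit_cong'[THEN iffD1])
    show "uniform_limit C (\<lambda>M s. left_eval (?U (u s)) (\<Sum>m<M. ?\<nu> ^ m * R (z s) ^ Suc m))
        (\<lambda>s. left_eval (?U (u s)) (G (z s))) sequentially"
      by (rule uniform_limit_bounded_additive[OF lim, where B = "1 + B"])
        (use zD order_trans[OF norm_left_eval_le eval_bound]
          linear_diff[OF bounded_linear.linear[OF bounded_linear_left_eval]] in auto)
    fix s assume s: "s \<in> C"
    show "left_eval (?U (u s)) (G (z s)) = SL 1 s (T + N)"
      using SL_SR_eq_eval(1)[OF u Q_TN[OF s] G_s[OF s], of 1] polar[of s, symmetric] by simp
    show "left_eval (?U (u s)) (\<Sum>m<M. ?\<nu> ^ m * R (z s) ^ Suc m)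
        = (\<Sum>m<M. op_power N m o\<^sub>L SL (m + 1) s T)" for M
      using SL_SR_eq_eval(1)[OF u Q_T[OF s] R_s[OF s], symmetric] polar[of s, symmetric]
      by (simp add: linear_sum[OF bounded_linear.linear[OF bounded_linear_left_eval]]
          complexify_op_power[symmetric] left_eval_complexify_mult del: power_Suc)
  qed
  show "uniform_limit C (\<lambda>M s. \<Sum>m<M. SR (m + 1) s T o\<^sub>L op_power N m)
      (\<lambda>s. SR 1 s (T + N)) sequentially"
  proof (rule uniform_limit_cong'[THEN iffD1])
    show "uniform_limit C (\<lambda>M s. right_eval (?U (u s)) (\<Sum>m<M. ?\<nu> ^ m * R (z s) ^ Suc m))
        (\<lambda>s. right_eval (?U (u s)) (G (z s))) sequentially"
      by (rule uniform_limit_bounded_additive[OF lim, where B = "1 + B"])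
        (use zD order_trans[OF norm_right_eval_le eval_bound]
          linear_diff[OF bounded_linear.linear[OF bounded_linear_right_eval]] in auto)
    fix s assume s: "s \<in> C"
    show "right_eval (?U (u s)) (G (z s)) = SR 1 s (T + N)"
      using SL_SR_eq_eval(2)[OF u Q_TN[OF s] G_s[OF s], of 1] polar[of s, symmetric] by simp
    \<comment> \<open>\<open>right_eval\<close> releases factors on the right only, so the powers of
      \<open>?\<nu>\<close> are first moved past those of the resolvent.\<close>
    have "(cplx.e (z s) - ?\<tau>) * ?\<nu> = ?\<nu> * (cplx.e (z s) - ?\<tau>)"
      by (simp add: left_diff_distrib right_diff_distrib comm cplx.e_commute[OF imag_unit_complexify])
    then have "R (z s) * ?\<nu> = ?\<nu> * R (z s)"
      by (rule is_inverse_commute[OF R_s[OF s]])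
    then have "?\<nu> ^ m * R (z s) ^ Suc m = R (z s) ^ Suc m * ?\<nu> ^ m" for m
      by (metis power_commuting_commutes)
    then show "right_eval (?U (u s)) (\<Sum>m<M. ?\<nu> ^ m * R (z s) ^ Suc m)
        = (\<Sum>m<M. SR (m + 1) s T o\<^sub>L op_power N m)" for M
      using SL_SR_eq_eval(2)[OF u Q_T[OF s] R_s[OF s], symmetric] polar[of s, symmetric]
      by (simp add: linear_sum[OF bounded_linear.linear[OF bounded_linear_right_eval]]
          complexify_op_power[symmetric] right_eval_mult_complexify del: power_Suc)
  qed
qed

theorem theorem6p4:
  fixes T N :: "('v::banach, 'n::{finite,linorder}) cop"
    and \<epsilon> :: real
  assumes "T \<in> B01" and "N \<in> B01"
    and "T o\<^sub>L N = N o\<^sub>L T"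
    and "\<epsilon> > 0"
    and "S_spectrum N \<subseteq> ball 0 \<epsilon>"
  shows "(\<forall>s\<in>S_resolvent_set T. dist_point_set s (S_spectrum T) > ereal \<epsilon> \<longrightarrow>
            s \<in> S_resolvent_set (T + N) \<and>
            (\<lambda>m. op_power N m o\<^sub>L SL (m + 1) s T) sums SL 1 s (T + N) \<and>
            (\<lambda>m. SR (m + 1) s T o\<^sub>L op_power N m) sums SR 1 s (T + N))
       \<and> (\<forall>C. dist_set_set C (S_spectrum T) > ereal \<epsilon> \<longrightarrow>
            uniform_limit C (\<lambda>M s. \<Sum>m<M. op_power N m o\<^sub>L SL (m + 1) s T)
              (\<lambda>s. SL 1 s (T + N)) sequentially \<and>
            uniform_limit C (\<lambda>M s. \<Sum>m<M. SR (m + 1) s T o\<^sub>L op_power N m)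
              (\<lambda>s. SR 1 s (T + N)) sequentially)"
proof (intro conjI ballI allI impI)
  fix s assume "dist_point_set s (S_spectrum T) > ereal \<epsilon>"
  \<comment> \<open>The pointwise claims are the uniform ones on the singleton
    \<open>{s}\<close>.\<close>
  then have "dist_set_set {s} (S_spectrum T) > ereal \<epsilon>"
    by (simp add: dist_set_set_def)
  note * = S_resolvent_series_uniform[OF assms(3-5) this]
  show "s \<in> S_resolvent_set (T + N)" using *(1) by simp
  show "(\<lambda>m. op_power N m o\<^sub>L SL (m + 1) s T) sums SL 1 s (T + N)"
    using *(2) unfolding sums_def by (rule tendsto_uniform_limitI) simp
  show "(\<lambda>m. SR (m + 1) s T o\<^sub>L op_power N m) sums SR 1 s (T + N)"
    using *(3) unfolding sums_def by (rule tendsto_uniform_limitI) simp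
qed (use S_resolvent_series_uniform[OF assms(3-5)] in blast)+

end
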